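(* Let $1=G_0\le G_1\le\cdots$ be an $r$-differential tower of groups with associated $r$-differential poset $P$, let $n\ge0$ and $k\in\mathbb{Z}$, and let $A:=DU_n+kI\in\mathbb{Z}^{p_n\times p_n}$. Then the last diagonal entry $s_{p_n}$ of the Smith normal form of $A$ over $\mathbb{Z}$ is $0$ when $A$ is singular, and when $A$ is nonsingular it equals (up to sign) $$s_{p_n}=\begin{cases}(n+1)!_{r,k}&\text{if } r\ge2,\\ (n-1)!_{1,k}\cdot(n+1+k)&\text{if } r=1.\end{cases}$$
   Context: An $r$-differential tower of groups is a chain of finite groups $1=G_0\le G_1\le\cdots$ such that restriction of irreducible characters from $G_n$ to $G_{n-1}$ is multiplicity-free and $\mathrm{Res}^{G_{n+1}}_{G_n}\mathrm{Ind}^{G_{n+1}}_{G_n}-\mathrm{Ind}^{G_n}_{G_{n-1}}\mathrm{Res}^{G_n}_{G_{n-1}}=r\cdot\mathrm{id}$ on the $\mathbb{Z}$-module of virtual characters of $G_n$ for all $n$ (second term $0$ for $n=0$). The associated poset $P$ has rank-$n$ set $P_n=\mathrm{Irr}(G_n)$ (so $p_n=|\mathrm{Irr}(G_n)|$), and $\psi\in\mathrm{Irr}(G_n)$ covers $\chi\in\mathrm{Irr}(G_{n-1})$ iff $\chi$ is a constituent of $\mathrm{Res}^{G_n}_{G_{n-1}}\psi$; it is an $r$-differential poset. Its up map $U_n:\mathbb{Z}^{P_n}\to\mathbb{Z}^{P_{n+1}}$ sends each element to the sum of the elements covering it, the down map $D_{n+1}=U_n^t$, and $DU_n=D_{n+1}U_n$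 (this is the matrix of $\mathrm{Res}^{G_{n+1}}_{G_n}\mathrm{Ind}^{G_{n+1}}_{G_n}$ in the basis $\mathrm{Irr}(G_n)$). For integers $\ell$, $\ell!_{r,k}:=(r\ell+k)(r(\ell-1)+k)\cdots(r\cdot1+k)$, an empty product (equal to $1$) when $\ell\le0$. *)

theory Defs
  imports "HOL-Algebra.Group" "Jordan_Normal_Form.Determinant"
begin

definition mtrace :: "complex mat \<Rightarrow> complex" where
  "mtrace A = (\<Sum>i<dim_row A. A $$ (i, i))"

definition mat_rep :: "('a, 'b) monoid_scheme \<Rightarrow> 'a set \<Rightarrow> nat \<Rightarrow> ('a \<Rightarrow> complex mat) \<Rightarrow> bool" where
  "mat_rep G K d \<rho> \<longleftrightarrow>
     (\<forall>x\<in>K. \<rho> x \<in> carrier_mat d d \<and> invertible_mat (\<rho> x)) \<and>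
     (\<forall>x\<in>K. \<forall>y\<in>K. \<rho> (x \<otimes>\<^bsub>G\<^esub> y) = \<rho> x * \<rho> y)"

text \<open>Reducible: similar to a representation in block upper triangular form with
  two diagonal blocks of positive size.\<close>
definition reducible_rep :: "'a set \<Rightarrow> nat \<Rightarrow> ('a \<Rightarrow> complex mat) \<Rightarrow> bool" where
  "reducible_rep K d \<rho> \<longleftrightarrow>
     (\<exists>P Q a. P \<in> carrier_mat d d \<and> Q \<in> carrier_mat d d \<and> P * Q = 1\<^sub>m d \<and>
        0 < a \<and> a < d \<and>
        (\<forall>x\<in>K. \<forall>i j. a \<le> i \<and> i < d \<and> j < a \<longrightarrow> (Q * \<rho> x * P) $$ (i, j) = 0))"

definition irreducible_rep :: "('a, 'b) monoid_scheme \<Rightarrow> 'a set \<Rightarrow> nat \<Rightarrow> ('a \<Rightarrow> complex mat) \<Rightarrow> bool" where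
  "irreducible_rep G K d \<rho> \<longleftrightarrow> 0 < d \<and> mat_rep G K d \<rho> \<and> \<not> reducible_rep K d \<rho>"

definition char_of :: "'a set \<Rightarrow> ('a \<Rightarrow> complex mat) \<Rightarrow> 'a \<Rightarrow> complex" where
  "char_of K \<rho> = (\<lambda>x. if x \<in> K then mtrace (\<rho> x) else 0)"

definition Irr :: "('a, 'b) monoid_scheme \<Rightarrow> 'a set \<Rightarrow> ('a \<Rightarrow> complex) set" where
  "Irr G K = {\<chi>. \<exists>d \<rho>. irreducible_rep G K d \<rho> \<and> \<chi> = char_of K \<rho>}"

definition vchar :: "('a, 'b) monoid_scheme \<Rightarrow> 'a set \<Rightarrow> ('a \<Rightarrow> complex) \<Rightarrow> bool" where
  "vchar G K f \<longleftrightarrow> (\<exists>c :: ('a \<Rightarrow> complex) \<Rightarrow> int.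
       f = (\<lambda>x. \<Sum>\<psi>\<in>Irr G K. of_int (c \<psi>) * \<psi> x))"

definition cinner :: "'a set \<Rightarrow> ('a \<Rightarrow> complex) \<Rightarrow> ('a \<Rightarrow> complex) \<Rightarrow> complex" where
  "cinner K f g = (\<Sum>x\<in>K. f x * cnj (g x)) / of_nat (card K)"

definition res :: "'a set \<Rightarrow> ('a \<Rightarrow> complex) \<Rightarrow> 'a \<Rightarrow> complex" where
  "res K f = (\<lambda>x. if x \<in> K then f x else 0)"

definition ind :: "('a, 'b) monoid_scheme \<Rightarrow> 'a set \<Rightarrow> 'a set \<Rightarrow> ('a \<Rightarrow> complex) \<Rightarrow> 'a \<Rightarrow> complex" where
  "ind G K L f = (\<lambda>g. if g \<in> L
      then (\<Sum>x\<in>L. res K f (x \<otimes>\<^bsub>G\<^esub> g \<otimes>\<^bsub>G\<^esub> inv\<^bsub>G\<^esub> x)) / of_nat (card K)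
      else 0)"

text \<open>The tower G_0 <= G_1 <= ... is modelled as a chain of finite subgroups H n of an
  ambient group G.\<close>
definition differential_tower :: "('a, 'b) monoid_scheme \<Rightarrow> (nat \<Rightarrow> 'a set) \<Rightarrow> int \<Rightarrow> bool" where
  "differential_tower G H r \<longleftrightarrow>
     group G \<and>
     (\<forall>n. subgroup (H n) G \<and> finite (H n) \<and> H n \<subseteq> H (Suc n)) \<and>
     H 0 = {\<one>\<^bsub>G\<^esub>} \<and>
     (\<forall>n. \<forall>\<chi>\<in>Irr G (H (Suc n)). \<forall>\<psi>\<in>Irr G (H n).
         cinner (H n) (res (H n) \<chi>) \<psi> \<in> {0, 1}) \<and>
     (\<forall>n f. vchar G (H n) f \<longrightarrow>
         (\<lambda>x. res (H n) (ind G (H n) (H (Suc n)) f) x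
              - (if n = 0 then 0 else ind G (H (n - 1)) (H n) (res (H (n - 1)) f) x))
         = (\<lambda>x. of_int r * f x))"

definition covers :: "('a, 'b) monoid_scheme \<Rightarrow> (nat \<Rightarrow> 'a set) \<Rightarrow> nat \<Rightarrow> ('a \<Rightarrow> complex) \<Rightarrow> ('a \<Rightarrow> complex) \<Rightarrow> bool" where
  "covers G H n \<psi> \<chi> \<longleftrightarrow> \<psi> \<in> Irr G (H (Suc n)) \<and> \<chi> \<in> Irr G (H n) \<and>
      cinner (H n) (res (H n) \<psi>) \<chi> \<noteq> 0"

text \<open>Up map U_n as a p_{n+1} x p_n 0/1 matrix, w.r.t. enumerations e of P_n and e' of P_{n+1}.\<close>
definition up_mat :: "('a, 'b) monoid_scheme \<Rightarrow> (nat \<Rightarrow> 'a set) \<Rightarrow> nat \<Rightarrow>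
    (nat \<Rightarrow> 'a \<Rightarrow> complex) \<Rightarrow> (nat \<Rightarrow> 'a \<Rightarrow> complex) \<Rightarrow> int mat" where
  "up_mat G H n e e' = mat (card (Irr G (H (Suc n)))) (card (Irr G (H n)))
      (\<lambda>(i, j). if covers G H n (e' i) (e j) then 1 else 0)"

text \<open>DU_n + kI, where D_{n+1} is the transpose of U_n.\<close>
definition DUk_mat :: "('a, 'b) monoid_scheme \<Rightarrow> (nat \<Rightarrow> 'a set) \<Rightarrow> nat \<Rightarrow>
    (nat \<Rightarrow> 'a \<Rightarrow> complex) \<Rightarrow> (nat \<Rightarrow> 'a \<Rightarrow> complex) \<Rightarrow> int \<Rightarrow> int mat" where
  "DUk_mat G H n e e' k =
     transpose_mat (up_mat G H n e e') * up_mat G H n e e'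
     + of_int k \<cdot>\<^sub>m 1\<^sub>m (card (Irr G (H n)))"

definition is_SNF :: "int mat \<Rightarrow> int mat \<Rightarrow> bool" where
  "is_SNF A S \<longleftrightarrow> (\<exists>p. A \<in> carrier_mat p p \<and> S \<in> carrier_mat p p \<and>
     (\<exists>P Q. P \<in> carrier_mat p p \<and> Q \<in> carrier_mat p p \<and>
            invertible_mat P \<and> invertible_mat Q \<and> S = P * A * Q) \<and>
     (\<forall>i<p. \<forall>j<p. i \<noteq> j \<longrightarrow> S $$ (i, j) = 0) \<and>
     (\<forall>i. Suc i < p \<longrightarrow> S $$ (i, i) dvd S $$ (Suc i, Suc i)))"

text \<open>l!_{r,k} = (r l + k)(r (l-1) + k) ... (r 1 + k); empty product if l <= 0.\<close>
definition rkfact :: "int \<Rightarrow> int \<Rightarrow> int \<Rightarrow> int" where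
  "rkfact r k l = (\<Prod>i\<in>{1..l}. r * i + k)"

end

theory Submission
  imports Defs "Jordan_Normal_Form.Spectral_Radius"
begin

text \<open>
  By orthonormality and completeness of the irreducible characters together with Frobenius
  reciprocity, the tower yields a differential poset: \<open>DU\<^sub>n = UD\<^sub>n + r\<close>, where \<open>UD\<^sub>n\<close> is \<open>U\<^bsub>n-1\<^esub> D\<^sub>n\<close>.
  If \<open>M\<close> is an integer matrix with \<open>(DU\<^bsub>n-1\<^esub> + r + k) M = c\<close>, then
  \<open>(DU\<^sub>n + k) (c - U M D) = (r + k) c\<close>; this recursion produces an integral multiple of the inverse
  of \<open>A = DU\<^sub>n + k I\<close> whose scaling factor is the product in the theorem. For \<open>r = 1\<close> the recursion
  starts at rank 1, which has a single element, and this accounts for the missing factor.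
  The last invariant factor of \<open>A\<close> is the least \<open>m > 0\<close> with \<open>m A\<inverse>\<close> integral, so it remains to
  see that this multiple is primitive. Counting covers shows that every element of positive rank with a
  unique lower cover, whose lower cover has at most \<open>r + 1\<close> upper covers, is itself the unique lower
  cover of some element. Hence two chains of such elements can be started above a common element
  and continued forever, and along them the recursion merely flips the sign of the matrix entry, which
  therefore is \<open>1\<close> or \<open>-1\<close>.
\<close>

section \<open>Matrices over a field\<close>

lemma index_mult_mat_sum:
  assumes "A \<in> carrier_mat n m" "B \<in> carrier_mat m p" "i < n" "j < p"
  shows "(A * B) $$ (i, j) = (\<Sum>l<m. A $$ (i, l) * B $$ (l, j))"
  using assms by (auto simp: scalar_prod_def atLeast0LessThan)

lemma det_nonzero_inverse:
  fixes A :: "'a :: field mat"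
  assumes A: "A \<in> carrier_mat n n" and d: "det A \<noteq> 0"
  obtains B where "B \<in> carrier_mat n n" "A * B = 1\<^sub>m n" "B * A = 1\<^sub>m n"
proof
  let ?B = "inverse (det A) \<cdot>\<^sub>m adj_mat A"
  note adj = adj_mat[OF A]
  show "?B \<in> carrier_mat n n" using adj by simp
  show "A * ?B = 1\<^sub>m n"
    using mult_smult_distrib[OF A adj(1), of "inverse (det A)"] adj(2) d
    by (auto intro!: eq_matI)
  show "?B * A = 1\<^sub>m n"
    using mult_smult_assoc_mat[OF adj(1) A, of "inverse (det A)"] adj(3) d
    by (auto intro!: eq_matI)
qed

section \<open>Elimination to the rank normal form\<close>

lemma first_column_completion:
  fixes u :: "'a :: field vec"
  assumes u: "u \<in> carrier_vec n" and i: "i0 < n" "u $ i0 \<noteq> 0"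
  obtains W where "W \<in> carrier_mat n n" "det W \<noteq> 0" "\<And>i. i < n \<Longrightarrow> W $$ (i, 0) = u $ i"
proof
  \<comment> \<open>Apart from \<open>u\<close> the columns are all unit vectors except the one of
    index \<open>i0\<close>: column \<open>i0\<close>, if it is not the first, takes over index 0.
    Hence row \<open>i0\<close> has \<open>u $ i0\<close> as its only nonzero entry.\<close>
  let ?f = "\<lambda>(i, j). if j = 0 then u $ i else if i = (if j = i0 then 0 else j) then 1 else 0"
  let ?W = "mat n n ?f"
  show W: "?W \<in> carrier_mat n n" by simp
  show "?W $$ (i, 0) = u $ i" if "i < n" for i using that by simp
  have "v = 0\<^sub>v n" if v: "v \<in> carrier_vec n" and z: "?W *\<^sub>v v = 0\<^sub>v n" for v
  proof -
    have s: "(\<Sum>j<n. ?f (i, j) * v $ j) = 0" if "i < n" for i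
    proof -
      have "(?W *\<^sub>v v) $ i = (\<Sum>j<n. ?f (i, j) * v $ j)"
        using that v by (auto simp: scalar_prod_def atLeast0LessThan intro!: sum.cong)
      with z that show ?thesis by simp
    qed
    \<comment> \<open>Row \<open>i0\<close> forces \<open>v $ 0 = 0\<close>; after that, the row
      with the 1 of column \<open>j\<close> reads off \<open>v $ j\<close>.\<close>
    have n: "0 < n" using i by simp
    have "(\<Sum>j<n. ?f (i0, j) * v $ j) = (\<Sum>j<n. if j = 0 then u $ i0 * v $ 0 else 0)"
      by (rule sum.cong) auto
    with s[OF i(1)] i n have v0: "v $ 0 = 0" by (simp add: sum.delta)
    have "v $ j = 0" if j: "j < n" for j
    proof (cases "j = 0")
      case False
      let ?i = "if j = i0 then 0 else j"
      have "(\<Sum>l<n. ?f (?i, l) * v $ l) = (\<Sum>l<n. if l = j then v $ j else 0)"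
        by (rule sum.cong) (use False v0 in auto)
      with s[of ?i] j n show ?thesis by (simp add: sum.delta split: if_splits)
    qed (use v0 in simp)
    with v show ?thesis by auto
  qed
  then show "det ?W \<noteq> 0" using det_0_iff_vec_prod_zero[OF W] by blast
qed

text \<open>Gaussian elimination by induction on the number of rows: a column with a nonzero entry
  is moved to the front and turned into the first unit vector, the rest of the first row is cleared,
  and the induction hypothesis treats the remaining block. Schur's lemma uses this form in place of
  kernels and images.\<close>

lemma rank_normal_form:
  fixes T :: "'a :: field mat"
  assumes "T \<in> carrier_mat m n"
  shows "\<exists>P Q a. P \<in> carrier_mat m m \<and> det P \<noteq> 0 \<and> Q \<in> carrier_mat n n \<and> det Q \<noteq> 0 \<and> a \<le> m \<and> a \<le> n \<and>
    P * T * Q = mat m n (\<lambda>(i, j). if i = j \<and> i < a then 1 else 0)"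
  using assms
proof (induction m arbitrary: n T)
  case 0
  then show ?case by (intro exI[of _ "1\<^sub>m 0"] exI[of _ "1\<^sub>m n"] exI[of _ 0]) (auto)
next
  case (Suc m)
  note T = Suc.prems
  show ?case
  proof (cases "\<exists>i<Suc m. \<exists>j<n. T $$ (i, j) \<noteq> 0")
    case False
    with T show ?thesis
      by (intro exI[of _ "1\<^sub>m (Suc m)"] exI[of _ "1\<^sub>m n"] exI[of _ 0]) (auto intro!: eq_matI)
  next
    case True
    then obtain i0 j0 where ij: "i0 < Suc m" "j0 < n" "T $$ (i0, j0) \<noteq> 0" by blast
    then obtain n' where n: "n = Suc n'" by (cases n) auto
    \<comment> \<open>The first column of \<open>Q0\<close> is a unit vector, so the first column of
      \<open>T * Q0\<close> is column \<open>j0\<close> of \<open>T\<close>.\<close>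
    obtain Q0 :: "'a mat" where Q0: "Q0 \<in> carrier_mat n n" "det Q0 \<noteq> 0"
      and Q0c: "\<And>i. i < n \<Longrightarrow> Q0 $$ (i, 0) = unit_vec n j0 $ i"
      using first_column_completion[of "unit_vec n j0" n j0] ij by auto
    obtain W where W: "W \<in> carrier_mat (Suc m) (Suc m)" "det W \<noteq> 0"
      and Wc: "\<And>i. i < Suc m \<Longrightarrow> W $$ (i, 0) = col T j0 $ i"
      using first_column_completion[of "col T j0" "Suc m" i0] ij T by auto
    \<comment> \<open>\<open>W\<close> maps the first unit vector to column \<open>j0\<close> of
      \<open>T\<close>; its inverse \<open>V\<close> maps that column back.\<close>
    obtain V where V: "V \<in> carrier_mat (Suc m) (Suc m)" "W * V = 1\<^sub>m (Suc m)" "V * W = 1\<^sub>m (Suc m)"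
      using det_nonzero_inverse[OF W] by metis
    have detV: "det V \<noteq> 0"
      using det_mult[OF V(1) W(1)] V(3) by auto
    have TQ: "(T * Q0) $$ (i, 0) = W $$ (i, 0)" if "i < Suc m" for i
    proof -
      have "(T * Q0) $$ (i, 0) = (\<Sum>l<n. T $$ (i, l) * Q0 $$ (l, 0))"
        using index_mult_mat_sum[OF T Q0(1) that] n by simp
      also have "\<dots> = (\<Sum>l<n. if l = j0 then T $$ (i, j0) else 0)"
        by (rule sum.cong) (use Q0c ij in auto)
      finally show ?thesis using Wc[OF that] ij T that by simp
    qed
    define B where "B = V * (T * Q0)"
    have B: "B \<in> carrier_mat (Suc m) (Suc n')" unfolding B_def using V T Q0 n by auto
    have B0: "B $$ (i, 0) = (if i = 0 then 1 else 0)" if "i < Suc m" for i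
    proof -
      have "B $$ (i, 0) = (\<Sum>l<Suc m. V $$ (i, l) * (T * Q0) $$ (l, 0))"
        unfolding B_def using index_mult_mat_sum[OF V(1) _ that, of "T * Q0" n 0] T Q0 n by auto
      also have "\<dots> = (\<Sum>l<Suc m. V $$ (i, l) * W $$ (l, 0))"
        by (rule sum.cong) (use TQ in auto)
      also have "\<dots> = (V * W) $$ (i, 0)"
        using index_mult_mat_sum[OF V(1) W(1) that, of 0] by simp
      finally show ?thesis using V(3) that by simp
    qed
    define w where "w = mat 1 n' (\<lambda>(i, j). B $$ (0, Suc j))"
    define T' where "T' = mat m n' (\<lambda>(i, j). B $$ (Suc i, Suc j))"
    have w: "w \<in> carrier_mat 1 n'" and T': "T' \<in> carrier_mat m n'" unfolding w_def T'_def by auto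
    have Bb: "B = four_block_mat (1\<^sub>m 1) w (0\<^sub>m m 1) T'"
      by (rule eq_matI) (use B B0 in \<open>auto simp: w_def T'_def not_less less_Suc_eq_0_disj\<close>)
    obtain P1 Q1 a where P1: "P1 \<in> carrier_mat m m" "det P1 \<noteq> 0"
      and Q1: "Q1 \<in> carrier_mat n' n'" "det Q1 \<noteq> 0" and a: "a \<le> m" "a \<le> n'"
      and D: "P1 * T' * Q1 = mat m n' (\<lambda>(i, j). if i = j \<and> i < a then 1 else 0)"
      using Suc.IH[OF T'] by blast
    let ?L = "four_block_mat (1\<^sub>m 1) (0\<^sub>m 1 m) (0\<^sub>m m 1) P1"
    \<comment> \<open>The block \<open>- w * Q1\<close> cancels the contribution
      \<open>w * Q1\<close> of the first row.\<close>
    let ?R = "four_block_mat (1\<^sub>m 1) (- w * Q1) (0\<^sub>m n' 1) Q1"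
    have L: "?L \<in> carrier_mat (Suc m) (Suc m)" and R: "?R \<in> carrier_mat (Suc n') (Suc n')"
      using P1 Q1 by auto
    have "det ?L = det P1"
      using det_four_block_mat_lower_left_zero[of "1\<^sub>m 1" 1 "0\<^sub>m 1 m" m "0\<^sub>m m 1" P1] P1 by simp
    moreover have "det ?R = det Q1"
      using det_four_block_mat_lower_left_zero[of "1\<^sub>m 1" 1 "- w * Q1" n' "0\<^sub>m n' 1" Q1] Q1 w by simp
    moreover have LB: "?L * B = four_block_mat (1\<^sub>m 1) w (0\<^sub>m m 1) (P1 * T')"
      unfolding Bb
      by (subst mult_four_block_mat[OF _ _ _ P1(1) _ w _ T']) (use w T' P1 in auto)
    moreover have "?L * B * ?R = four_block_mat (1\<^sub>m 1) (0\<^sub>m 1 n') (0\<^sub>m m 1) (P1 * T' * Q1)"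
      unfolding LB
      by (subst mult_four_block_mat[of _ 1 1 _ n' _ m _ _ 1 _ n'])
        (use w T' P1 Q1 in \<open>auto intro!: arg_cong4[where f=four_block_mat] simp: uminus_l_inv_mat\<close>)
    moreover have "\<dots> = mat (Suc m) n (\<lambda>(i, j). if i = j \<and> i < Suc a then 1 else 0)"
      unfolding D by (rule eq_matI) (auto simp: n not_less less_Suc_eq_0_disj split: if_splits)
    moreover have "?L * B * ?R = (?L * V) * T * (Q0 * ?R)"
      unfolding B_def using L V T Q0 R n
      by (smt (verit) assoc_mult_mat mult_carrier_mat)
    ultimately show ?thesis using P1 Q1 L R V Q0 W detV a n
      by (intro exI[of _ "?L * V"] exI[of _ "Q0 * ?R"] exI[of _ "Suc a"]) (auto simp: det_mult)
  qed
qed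

section \<open>Traces\<close>

lemma mtrace_mult_comm:
  assumes A: "A \<in> carrier_mat n m" and B: "B \<in> carrier_mat m n"
  shows "mtrace (A * B) = mtrace (B * A)"
proof -
  have "mtrace (A * B) = (\<Sum>i<n. \<Sum>l<m. A $$ (i, l) * B $$ (l, i))"
    unfolding mtrace_def using index_mult_mat_sum[OF A B] A by (intro sum.cong) auto
  also have "\<dots> = (\<Sum>l<m. \<Sum>i<n. B $$ (l, i) * A $$ (i, l))"
    by (subst sum.swap) (simp add: mult.commute)
  also have "\<dots> = mtrace (B * A)"
    unfolding mtrace_def using index_mult_mat_sum[OF B A] B by (intro sum.cong) auto
  finally show ?thesis .
qed

lemma mtrace_similar:
  assumes "A \<in> carrier_mat n n" "P \<in> carrier_mat n n" "Q \<in> carrier_mat n n" "P * Q = 1\<^sub>m n"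
  shows "mtrace (Q * A * P) = mtrace A"
proof -
  have "mtrace (Q * A * P) = mtrace (Q * (A * P))" using assms by (simp add: assoc_mult_mat[of _ n n _ n _ n])
  also have "\<dots> = mtrace ((A * P) * Q)" using assms by (intro mtrace_mult_comm[of _ n n]) auto
  also have "(A * P) * Q = A" using assms by (simp add: assoc_mult_mat[of _ n n _ n _ n])
  finally show ?thesis .
qed

lemma mtrace_carrier: "A \<in> carrier_mat d d \<Longrightarrow> mtrace A = (\<Sum>i<d. A $$ (i, i))"
  by (auto simp: mtrace_def)

lemma sum_lessThan_split:
  fixes f :: "nat \<Rightarrow> 'a :: comm_monoid_add"
  assumes "a \<le> d"
  shows "(\<Sum>l<d. f l) = (\<Sum>l<a. f l) + (\<Sum>l<d - a. f (a + l))"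
proof -
  have "(\<Sum>l<d. f l) = (\<Sum>l<a. f l) + (\<Sum>l\<in>{a..<d}. f l)"
    using sum.atLeastLessThan_concat[of 0 a d f] assms by (simp add: atLeast0LessThan)
  also have "(\<Sum>l\<in>{a..<d}. f l) = (\<Sum>l<d - a. f (a + l))"
    by (rule sum.reindex_bij_witness[of _ "\<lambda>l. a + l" "\<lambda>l. l - a"]) auto
  finally show ?thesis .
qed

section \<open>Representations of finite groups\<close>

locale finite_subgroup = group G for G :: "('a, 'b) monoid_scheme" (structure) +
  fixes K :: "'a set"
  assumes subgroup_K: "subgroup K G" and finite_K: "finite K"
begin

lemma one_K [simp]: "\<one> \<in> K" and mult_K [simp]: "x \<in> K \<Longrightarrow> y \<in> K \<Longrightarrow> x \<otimes> y \<in> K"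
  and inv_K [simp]: "x \<in> K \<Longrightarrow> inv x \<in> K" and carrier_K [simp]: "x \<in> K \<Longrightarrow> x \<in> carrier G"
  using subgroup_K by (auto simp: subgroup.one_closed subgroup.m_closed subgroup.m_inv_closed subgroup.mem_carrier)

lemma card_K: "of_nat (card K) \<noteq> (0 :: complex)"
  using finite_K one_K by (metis card_gt_0_iff empty_iff of_nat_eq_0_iff less_irrefl)

lemma sum_left_translate: "h \<in> K \<Longrightarrow> (\<Sum>g\<in>K. f (h \<otimes> g)) = (\<Sum>g\<in>K. f g)"
  by (rule sum.reindex_bij_witness[of _ "\<lambda>g. inv h \<otimes> g" "\<lambda>g. h \<otimes> g"]) (auto simp: m_assoc[symmetric])

lemma sum_right_translate: "h \<in> K \<Longrightarrow> (\<Sum>g\<in>K. f (g \<otimes> h)) = (\<Sum>g\<in>K. f g)"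
  by (rule sum.reindex_bij_witness[of _ "\<lambda>g. g \<otimes> inv h" "\<lambda>g. g \<otimes> h"]) (auto simp: m_assoc)

lemma rep_carrier: "mat_rep G K d \<rho> \<Longrightarrow> x \<in> K \<Longrightarrow> \<rho> x \<in> carrier_mat d d"
  and rep_mult: "mat_rep G K d \<rho> \<Longrightarrow> x \<in> K \<Longrightarrow> y \<in> K \<Longrightarrow> \<rho> (x \<otimes> y) = \<rho> x * \<rho> y"
  unfolding mat_rep_def by auto

text \<open>The image of \<open>\<one>\<close> is idempotent and invertible, hence the
  identity.\<close>

lemma rep_one:
  assumes "mat_rep G K d \<rho>"
  shows "\<rho> \<one> = 1\<^sub>m d"
proof -
  have c: "\<rho> \<one> \<in> carrier_mat d d" using assms rep_carrier by simp
  have e: "\<rho> \<one> * \<rho> \<one> = \<rho> \<one>" using rep_mult[OF assms one_K one_K] by simp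
  have "invertible_mat (\<rho> \<one>)" using assms by (simp add: mat_rep_def)
  then obtain B where B: "\<rho> \<one> * B = 1\<^sub>m d" "B * \<rho> \<one> = 1\<^sub>m (dim_row B)"
    using c by (auto simp: invertible_mat_def inverts_mat_def)
  then have Bc: "B \<in> carrier_mat d d"
    using c by (metis carrier_matI carrier_matD index_mult_mat(2,3) index_one_mat(2,3))
  have "\<rho> \<one> = \<rho> \<one> * (\<rho> \<one> * B)" using B c by simp
  also have "\<dots> = \<rho> \<one> * \<rho> \<one> * B" using c Bc by (simp add: assoc_mult_mat[of _ d d _ d _ d])
  finally show ?thesis using e B by simp
qed

lemma rep_inverse:
  assumes "mat_rep G K d \<rho>" "x \<in> K"
  shows "\<rho> (inv x) * \<rho> x = 1\<^sub>m d" "\<rho> x * \<rho> (inv x) = 1\<^sub>m d"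
  using rep_mult[OF assms(1), of "inv x" x] rep_mult[OF assms(1), of x "inv x"] assms rep_one[OF assms(1)]
  by simp_all

text \<open>Invertibility of \<open>\<rho> x\<close> follows from multiplicativity, with
  \<open>\<rho> (inv x)\<close> as inverse.\<close>

lemma mat_repI:
  assumes c: "\<And>x. x \<in> K \<Longrightarrow> \<rho> x \<in> carrier_mat d d" and o: "\<rho> \<one> = 1\<^sub>m d"
    and m: "\<And>x y. x \<in> K \<Longrightarrow> y \<in> K \<Longrightarrow> \<rho> (x \<otimes> y) = \<rho> x * \<rho> y"
  shows "mat_rep G K d \<rho>"
proof -
  have "invertible_mat (\<rho> x)" if x: "x \<in> K" for x
  proof -
    have "\<rho> x * \<rho> (inv x) = 1\<^sub>m d" "\<rho> (inv x) * \<rho> x = 1\<^sub>m d"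
      using m[of x "inv x"] m[of "inv x" x] x o by simp_all
    then show ?thesis using c[OF x] c[of "inv x"] x
      by (auto simp: invertible_mat_def inverts_mat_def)
  qed
  with c m show ?thesis by (auto simp: mat_rep_def)
qed

section \<open>Block triangular representations and decomposition of characters\<close>

lemma char_of_block_triangular:
  assumes rep: "mat_rep G K d \<rho>" and P: "P \<in> carrier_mat d d" and Q: "Q \<in> carrier_mat d d"
    and PQ: "P * Q = 1\<^sub>m d" and a: "a < d"
    and tri: "\<And>x i j. x \<in> K \<Longrightarrow> a \<le> i \<Longrightarrow> i < d \<Longrightarrow> j < a \<Longrightarrow> (Q * \<rho> x * P) $$ (i, j) = 0"
  defines "\<sigma> \<equiv> \<lambda>x. mat a a (\<lambda>(i, j). (Q * \<rho> x * P) $$ (i, j))"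
    and "\<tau> \<equiv> \<lambda>x. mat (d - a) (d - a) (\<lambda>(i, j). (Q * \<rho> x * P) $$ (a + i, a + j))"
  shows "mat_rep G K a \<sigma>" "mat_rep G K (d - a) \<tau>"
    "char_of K \<rho> = (\<lambda>x. char_of K \<sigma> x + char_of K \<tau> x)"
proof -
  define R where "R x = Q * \<rho> x * P" for x
  have R: "R x \<in> carrier_mat d d" if "x \<in> K" for x
    unfolding R_def using rep_carrier[OF rep that] P Q by auto
  have QP: "Q * P = 1\<^sub>m d" using mat_mult_left_right_inverse[OF P Q PQ] .
  have R1: "R \<one> = 1\<^sub>m d" unfolding R_def using rep_one[OF rep] QP Q by simp
  have Rm: "R (x \<otimes> y) = R x * R y" if "x \<in> K" "y \<in> K" for x y
  proof -
    note c = rep_carrier[OF rep that(1)] rep_carrier[OF rep that(2)]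
    have "R x * R y = Q * \<rho> x * (P * Q) * (\<rho> y * P)"
      unfolding R_def using c P Q by (smt (verit) assoc_mult_mat mult_carrier_mat)
    also have "\<dots> = Q * (\<rho> x * \<rho> y) * P"
      using c P Q unfolding PQ by (smt (verit) assoc_mult_mat mult_carrier_mat right_mult_one_mat)
    finally show ?thesis unfolding R_def using rep_mult[OF rep that] by simp
  qed
  \<comment> \<open>The inner index is split at \<open>a\<close>. On either diagonal block one of
    the two sums vanishes because the lower left block does, so each block is multiplicative by
    itself.\<close>
  have ent: "R (x \<otimes> y) $$ (i, j) = (\<Sum>l<a. R x $$ (i, l) * R y $$ (l, j)) + (\<Sum>l<d-a. R x $$ (i, a + l) * R y $$ (a + l, j))"
    if "x \<in> K" "y \<in> K" "i < d" "j < d" for x y i j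
  proof -
    have "R (x \<otimes> y) $$ (i, j) = (\<Sum>l<d. R x $$ (i, l) * R y $$ (l, j))"
      unfolding Rm[OF that(1,2)] by (rule index_mult_mat_sum[OF R[OF that(1)] R[OF that(2)] that(3,4)])
    also have "\<dots> = (\<Sum>l<a. R x $$ (i, l) * R y $$ (l, j)) + (\<Sum>l<d-a. R x $$ (i, a + l) * R y $$ (a + l, j))"
      using a by (intro sum_lessThan_split) simp
    finally show ?thesis .
  qed
  have z: "R x $$ (i, j) = 0" if "x \<in> K" "a \<le> i" "i < d" "j < a" for x i j
    using tri that unfolding R_def by simp
  show "mat_rep G K a \<sigma>"
  proof (rule mat_repI)
    show "\<sigma> x \<in> carrier_mat a a" for x by (simp add: \<sigma>_def)
    show "\<sigma> \<one> = 1\<^sub>m a"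
      by (rule eq_matI) (use a in \<open>auto simp: \<sigma>_def R_def[symmetric] R1\<close>)
    show "\<sigma> (x \<otimes> y) = \<sigma> x * \<sigma> y" if "x \<in> K" "y \<in> K" for x y
    proof (rule eq_matI)
      fix i j assume "i < dim_row (\<sigma> x * \<sigma> y)" "j < dim_col (\<sigma> x * \<sigma> y)"
      then have ij: "i < a" "j < a" by (auto simp: \<sigma>_def)
      have "(\<sigma> x * \<sigma> y) $$ (i, j) = (\<Sum>l<a. R x $$ (i, l) * R y $$ (l, j))"
        by (subst index_mult_mat_sum[of _ a a _ a]) (use ij in \<open>auto simp: \<sigma>_def R_def\<close>)
      also have "\<dots> = R (x \<otimes> y) $$ (i, j)" using ent[OF that, of i j] z[OF that(2)] a ij by simp
      finally show "\<sigma> (x \<otimes> y) $$ (i, j) = (\<sigma> x * \<sigma> y) $$ (i, j)"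
        using ij by (simp add: \<sigma>_def R_def)
    qed (auto simp: \<sigma>_def)
  qed
  show "mat_rep G K (d - a) \<tau>"
  proof (rule mat_repI)
    show "\<tau> x \<in> carrier_mat (d - a) (d - a)" for x by (simp add: \<tau>_def)
    show "\<tau> \<one> = 1\<^sub>m (d - a)"
      by (rule eq_matI) (use a in \<open>auto simp: \<tau>_def R_def[symmetric] R1\<close>)
    show "\<tau> (x \<otimes> y) = \<tau> x * \<tau> y" if "x \<in> K" "y \<in> K" for x y
    proof (rule eq_matI)
      fix i j assume "i < dim_row (\<tau> x * \<tau> y)" "j < dim_col (\<tau> x * \<tau> y)"
      then have ij: "i < d - a" "j < d - a" by (auto simp: \<tau>_def)
      have "(\<tau> x * \<tau> y) $$ (i, j) = (\<Sum>l<d-a. R x $$ (a + i, a + l) * R y $$ (a + l, a + j))"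
        by (subst index_mult_mat_sum[of _ "d-a" "d-a" _ "d-a"]) (use ij in \<open>auto simp: \<tau>_def R_def\<close>)
      also have "\<dots> = R (x \<otimes> y) $$ (a + i, a + j)" using ent[OF that, of "a + i" "a + j"] z[OF that(1)] a ij by simp
      finally show "\<tau> (x \<otimes> y) $$ (i, j) = (\<tau> x * \<tau> y) $$ (i, j)"
        using ij by (simp add: \<tau>_def R_def)
    qed (auto simp: \<tau>_def)
  qed
  show "char_of K \<rho> = (\<lambda>x. char_of K \<sigma> x + char_of K \<tau> x)"
  proof
    fix x show "char_of K \<rho> x = char_of K \<sigma> x + char_of K \<tau> x"
    proof (cases "x \<in> K")
      case True
      have "mtrace (\<rho> x) = mtrace (R x)"
        unfolding R_def using mtrace_similar[OF rep_carrier[OF rep True] P Q PQ] by simp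
      also have "\<dots> = (\<Sum>i<d. R x $$ (i, i))" using R[OF True] by (rule mtrace_carrier)
      also have "\<dots> = (\<Sum>i<a. R x $$ (i, i)) + (\<Sum>i<d-a. R x $$ (a+i, a+i))"
        using a by (intro sum_lessThan_split) simp
      also have "\<dots> = mtrace (\<sigma> x) + mtrace (\<tau> x)" by (simp add: mtrace_def \<sigma>_def \<tau>_def R_def)
      finally show ?thesis using True by (simp add: char_of_def)
    qed (simp add: char_of_def)
  qed
qed

text \<open>Induction on the degree: the trace of a block triangular matrix sees only the diagonal
  blocks, so the character of a reducible representation is the sum of two characters of smaller
  degree.\<close>

lemma char_of_decomposition:
  "mat_rep G K d \<rho> \<Longrightarrow> \<exists>cs. set cs \<subseteq> Irr G K \<and> char_of K \<rho> = (\<lambda>x. \<Sum>\<chi>\<leftarrow>cs. \<chi> x)"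
proof (induction d arbitrary: \<rho> rule: less_induct)
  case (less d)
  note rep = less.prems
  consider "d = 0" | "irreducible_rep G K d \<rho>" | "reducible_rep K d \<rho>"
    using rep by (auto simp: irreducible_rep_def)
  then show ?case
  proof cases
    case 1
    then have "char_of K \<rho> = (\<lambda>x. 0)"
      using mtrace_carrier[OF rep_carrier[OF rep]] by (auto simp: char_of_def)
    then show ?thesis by (intro exI[of _ "[]"]) auto
  next
    case 2
    then show ?thesis by (intro exI[of _ "[char_of K \<rho>]"]) (auto simp: Irr_def)
  next
    case 3
    then obtain P Q a where PQ: "P \<in> carrier_mat d d" "Q \<in> carrier_mat d d" "P * Q = 1\<^sub>m d"
      and a: "0 < a" "a < d"
      and tri: "\<And>x i j. x \<in> K \<Longrightarrow> a \<le> i \<Longrightarrow> i < d \<Longrightarrow> j < a \<Longrightarrow> (Q * \<rho> x * P) $$ (i, j) = 0"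
      unfolding reducible_rep_def by blast
    from char_of_block_triangular[OF rep PQ a(2) tri] obtain \<sigma> \<tau>
      where s: "mat_rep G K a \<sigma>" and t: "mat_rep G K (d - a) \<tau>"
        and eq: "char_of K \<rho> = (\<lambda>x. char_of K \<sigma> x + char_of K \<tau> x)" by blast
    from less.IH[OF a(2) s] obtain cs where cs: "set cs \<subseteq> Irr G K" "char_of K \<sigma> = (\<lambda>x. \<Sum>\<chi>\<leftarrow>cs. \<chi> x)" by blast
    from less.IH[OF _ t] a obtain ds where ds: "set ds \<subseteq> Irr G K" "char_of K \<tau> = (\<lambda>x. \<Sum>\<chi>\<leftarrow>ds. \<chi> x)" by auto
    show ?thesis using cs ds eq by (intro exI[of _ "cs @ ds"]) auto
  qed
qed

lemma reducible_rep_lower: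
  assumes P: "P \<in> carrier_mat d d" and Q: "Q \<in> carrier_mat d d"
    and rep: "mat_rep G K d \<rho>"
    and PQ: "P * Q = 1\<^sub>m d" and a: "0 < a" "a < d"
    and tri: "\<And>x i j. x \<in> K \<Longrightarrow> i < a \<Longrightarrow> a \<le> j \<Longrightarrow> j < d \<Longrightarrow> (Q * \<rho> x * P) $$ (i, j) = 0"
  shows "reducible_rep K d \<rho>"
proof -
  \<comment> \<open>Reversing the order of the basis turns lower into upper triangular blocks.\<close>
  let ?P = "mat d d (\<lambda>(i, j). P $$ (i, d - 1 - j))"
  let ?Q = "mat d d (\<lambda>(i, j). Q $$ (d - 1 - i, j))"
  have c: "?P \<in> carrier_mat d d" "?Q \<in> carrier_mat d d" by auto
  have "?P * ?Q = P * Q"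
  proof (rule eq_matI)
    fix i j assume "i < dim_row (P * Q)" "j < dim_col (P * Q)"
    then have ij: "i < d" "j < d" using P Q by auto
    have "(?P * ?Q) $$ (i, j) = (\<Sum>l<d. P $$ (i, d - 1 - l) * Q $$ (d - 1 - l, j))"
      by (subst index_mult_mat_sum[OF c ij]) (use ij in auto)
    also have "\<dots> = (\<Sum>l<d. P $$ (i, l) * Q $$ (l, j))"
      by (rule sum.reindex_bij_witness[of _ "\<lambda>l. d - 1 - l" "\<lambda>l. d - 1 - l"]) auto
    also have "\<dots> = (P * Q) $$ (i, j)" by (rule index_mult_mat_sum[OF P Q ij, symmetric])
    finally show "(?P * ?Q) $$ (i, j) = (P * Q) $$ (i, j)" .
  qed (use P Q in auto)
  moreover have "(?Q * \<rho> x * ?P) $$ (i, j) = 0" if x: "x \<in> K" and ij: "d - a \<le> i" "i < d" "j < d - a" for x i j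
  proof -
    have ij': "d - 1 - i < d" "d - 1 - j < d" and j: "j < d" using ij by auto
    note r = rep_carrier[OF rep x]
    have q: "(?Q * \<rho> x) $$ (i, l) = (Q * \<rho> x) $$ (d - 1 - i, l)" if "l < d" for l
      using index_mult_mat_sum[OF c(2) r ij(2) that] index_mult_mat_sum[OF Q r ij'(1) that] ij that by simp
    have "(?Q * \<rho> x * ?P) $$ (i, j) = (\<Sum>l<d. (?Q * \<rho> x) $$ (i, l) * ?P $$ (l, j))"
      by (rule index_mult_mat_sum[OF _ c(1) ij(2) j]) (use c r in auto)
    also have "\<dots> = (\<Sum>l<d. (Q * \<rho> x) $$ (d - 1 - i, l) * P $$ (l, d - 1 - j))"
      by (rule sum.cong) (use q j in auto)
    also have "\<dots> = (Q * \<rho> x * P) $$ (d - 1 - i, d - 1 - j)"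
      by (rule index_mult_mat_sum[OF _ P ij', symmetric]) (use Q r in auto)
    also have "\<dots> = 0" using tri[OF x, of "d - 1 - i" "d - 1 - j"] ij a by auto
    finally show ?thesis .
  qed
  ultimately show ?thesis unfolding reducible_rep_def
    using c PQ a by (intro exI[of _ ?P] exI[of _ ?Q] exI[of _ "d - a"]) auto
qed

section \<open>Schur's lemma\<close>

text \<open>In suitable bases \<open>T\<close> is an identity block of size \<open>a\<close> padded
  with zeros. Commuting with it makes the conjugated \<open>\<rho>\<close> block upper triangular
  and the conjugated \<open>\<sigma>\<close> block lower triangular at \<open>a\<close>. As
  \<open>a > 0\<close>, irreducibility leaves only \<open>a = d\<close> and
  \<open>a = d'\<close>.\<close>

lemma schur_lemma:
  assumes rho: "irreducible_rep G K d \<rho>" and sig: "irreducible_rep G K d' \<sigma>"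
    and T: "T \<in> carrier_mat d d'" and tw: "\<And>x. x \<in> K \<Longrightarrow> \<rho> x * T = T * \<sigma> x"
    and nz: "T \<noteq> 0\<^sub>m d d'"
  shows "d = d'" "det T \<noteq> 0"
proof -
  note rep = rho[unfolded irreducible_rep_def] sig[unfolded irreducible_rep_def]
  from rep have r: "mat_rep G K d \<rho>" and s: "mat_rep G K d' \<sigma>" by auto
  from rank_normal_form[OF T] obtain P Q a where P: "P \<in> carrier_mat d d" "det P \<noteq> 0"
    and Q: "Q \<in> carrier_mat d' d'" "det Q \<noteq> 0" and a: "a \<le> d" "a \<le> d'"
    and D: "P * T * Q = mat d d' (\<lambda>(i, j). if i = j \<and> i < a then 1 else 0)" (is "_ = ?D") by blast
  obtain P' where P': "P' \<in> carrier_mat d d" "P * P' = 1\<^sub>m d" "P' * P = 1\<^sub>m d"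
    using det_nonzero_inverse[OF P] .
  obtain Q' where Q': "Q' \<in> carrier_mat d' d'" "Q * Q' = 1\<^sub>m d'" "Q' * Q = 1\<^sub>m d'"
    using det_nonzero_inverse[OF Q] .
  have a0: "0 < a"
  proof (rule ccontr)
    assume "\<not> 0 < a"
    then have "?D = 0\<^sub>m d d'" by (auto intro!: eq_matI)
    then have z: "P * T * Q = 0\<^sub>m d d'" using D by simp
    have "T = P' * P * T * (Q * Q')" using P' Q' T by simp
    also have "\<dots> = P' * (P * T * Q) * Q'"
      using P P' Q Q' T by (smt (verit) assoc_mult_mat mult_carrier_mat)
    also have "\<dots> = 0\<^sub>m d d'" using z P' Q' by simp
    finally show False using nz by simp
  qed
  have Dc: "?D \<in> carrier_mat d d'" by simp
  \<comment> \<open>The intertwining relation after the base changes. Right multiplication by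
    \<open>?D\<close> keeps the first \<open>a\<close> columns and left multiplication keeps the
    first \<open>a\<close> rows (\<open>R\<close> and \<open>L\<close> below), so comparing entries
    produces the zero blocks.\<close>
  have key: "(P * \<rho> x * P') * ?D = ?D * (Q' * \<sigma> x * Q)" if x: "x \<in> K" for x
  proof -
    note c = rep_carrier[OF r x] rep_carrier[OF s x]
    have "(P * \<rho> x * P') * ?D = P * \<rho> x * (P' * P) * T * Q"
      unfolding D[symmetric] using P P' T Q c by (smt (verit) assoc_mult_mat mult_carrier_mat)
    also have "\<dots> = P * (\<rho> x * T) * Q"
      unfolding P' using P T Q c by (smt (verit) assoc_mult_mat mult_carrier_mat right_mult_one_mat)
    also have "\<dots> = P * (T * (Q * Q') * \<sigma> x) * Q"
      unfolding tw[OF x] Q' using T by simp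
    also have "\<dots> = (P * T * Q) * (Q' * \<sigma> x * Q)"
      using P T Q Q' c by (smt (verit) assoc_mult_mat mult_carrier_mat)
    finally show ?thesis unfolding D .
  qed
  have R: "(X * ?D) $$ (i, j) = (if j < a then X $$ (i, j) else 0)"
    if "X \<in> carrier_mat d d" "i < d" "j < d'" for X i j
  proof -
    have "(X * ?D) $$ (i, j) = (\<Sum>l<d. X $$ (i, l) * ?D $$ (l, j))"
      by (rule index_mult_mat_sum[OF that(1) Dc that(2,3)])
    also have "\<dots> = (\<Sum>l<d. if l = j then (if j < a then X $$ (i, j) else 0) else 0)"
      by (rule sum.cong) (use that in auto)
    finally show ?thesis using a by auto
  qed
  have L: "(?D * X) $$ (i, j) = (if i < a then X $$ (i, j) else 0)"
    if "X \<in> carrier_mat d' d'" "i < d" "j < d'" for X i j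
  proof -
    have "(?D * X) $$ (i, j) = (\<Sum>l<d'. ?D $$ (i, l) * X $$ (l, j))"
      by (rule index_mult_mat_sum[OF Dc that])
    also have "\<dots> = (\<Sum>l<d'. if l = i then (if i < a then X $$ (i, j) else 0) else 0)"
      by (rule sum.cong) (use that in auto)
    finally show ?thesis using a by auto
  qed
  have car: "P * \<rho> x * P' \<in> carrier_mat d d" "Q' * \<sigma> x * Q \<in> carrier_mat d' d'" if "x \<in> K" for x
    using rep_carrier[OF r that] rep_carrier[OF s that] P P' Q Q' by auto
  have ad: "a = d"
  proof (rule ccontr)
    assume "a \<noteq> d"
    with a have "a < d" by simp
    have "(P * \<rho> x * P') $$ (i, j) = 0" if x: "x \<in> K" and "a \<le> i" "i < d" "j < a" for x i j
      using arg_cong[OF key[OF x], of "\<lambda>M. M $$ (i, j)"] R[OF car(1)[OF x], of i j] L[OF car(2)[OF x], of i j] that a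
      by simp
    with \<open>a < d\<close> a0 P P' have "reducible_rep K d \<rho>"
      unfolding reducible_rep_def by (intro exI[of _ P'] exI[of _ P] exI[of _ a]) auto
    with rep show False by simp
  qed
  \<comment> \<open>For \<open>\<sigma>\<close> the zero block lies at the upper right, which calls
    for the lower triangular criterion of reducibility.\<close>
  have ad': "a = d'"
  proof (rule ccontr)
    assume "a \<noteq> d'"
    with a have "a < d'" by simp
    have "(Q' * \<sigma> x * Q) $$ (i, j) = 0" if x: "x \<in> K" and "i < a" "a \<le> j" "j < d'" for x i j
      using arg_cong[OF key[OF x], of "\<lambda>M. M $$ (i, j)"] R[OF car(1)[OF x], of i j] L[OF car(2)[OF x], of i j] that a
      by simp
    with \<open>a < d'\<close> a0 Q Q' s have "reducible_rep K d' \<sigma>"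
      by (intro reducible_rep_lower[of Q d' Q' \<sigma> a]) auto
    with rep show False by simp
  qed
  show dd: "d = d'" using ad ad' by simp
  have "?D = 1\<^sub>m d" using ad ad' by (auto intro!: eq_matI)
  then have "det (P * T * Q) = 1" using D by simp
  moreover have "det (P * T * Q) = det P * det T * det Q"
    using P T Q dd det_mult[of "P * T" d Q] det_mult[of P d T] by simp
  ultimately show "det T \<noteq> 0" by auto
qed

lemma intertwined_char_of_eq:
  assumes r: "mat_rep G K d \<rho>" and s: "mat_rep G K d \<sigma>"
    and T: "T \<in> carrier_mat d d" "det T \<noteq> 0" and tw: "\<And>x. x \<in> K \<Longrightarrow> \<rho> x * T = T * \<sigma> x"
  shows "char_of K \<rho> = char_of K \<sigma>"
proof
  fix x
  show "char_of K \<rho> x = char_of K \<sigma> x"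
  proof (cases "x \<in> K")
    case True
    obtain T' where T': "T' \<in> carrier_mat d d" "T * T' = 1\<^sub>m d" "T' * T = 1\<^sub>m d"
      using det_nonzero_inverse[OF T] .
    note c = rep_carrier[OF r True] rep_carrier[OF s True]
    have "T' * \<rho> x * T = T' * (\<rho> x * T)"
      using c T T' by simp
    also have "\<dots> = T' * T * \<sigma> x"
      unfolding tw[OF True] by (rule assoc_mult_mat[OF T'(1) T(1) c(2), symmetric])
    also have "\<dots> = \<sigma> x" unfolding T' using c by simp
    finally have "mtrace (\<sigma> x) = mtrace (\<rho> x)"
      using mtrace_similar[OF c(1) T(1) T'(1,2)] by simp
    then show ?thesis by (simp add: char_of_def)
  qed (simp add: char_of_def)
qed

text \<open>Over the complex numbers \<open>T\<close> has an eigenvalue \<open>c\<close>. The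
  intertwiner \<open>T - c\<close> is singular, so by Schur's lemma it is zero.\<close>

lemma schur_scalar:
  assumes rho: "irreducible_rep G K d \<rho>"
    and T: "T \<in> carrier_mat d d" and tw: "\<And>x. x \<in> K \<Longrightarrow> \<rho> x * T = T * \<rho> x"
  obtains c where "T = c \<cdot>\<^sub>m 1\<^sub>m d"
proof -
  from rho have d: "0 < d" and r: "mat_rep G K d \<rho>" by (auto simp: irreducible_rep_def)
  from spectrum_non_empty[OF T d] obtain c where c: "eigenvalue T c" by (auto simp: spectrum_def)
  let ?S = "char_matrix T c"
  have S: "?S = T + (- c) \<cdot>\<^sub>m 1\<^sub>m d" using T by (simp add: char_matrix_def)
  have Sc: "?S \<in> carrier_mat d d" using S T by simp
  have "det ?S = 0" using eigenvalue_det[OF T] c by simp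
  moreover have "\<rho> x * ?S = ?S * \<rho> x" if "x \<in> K" for x
  proof -
    note cx = rep_carrier[OF r that]
    have "\<rho> x * ?S = \<rho> x * T + \<rho> x * ((- c) \<cdot>\<^sub>m 1\<^sub>m d)"
      unfolding S using cx T by (intro mult_add_distrib_mat) auto
    also have "\<dots> = T * \<rho> x + ((- c) \<cdot>\<^sub>m 1\<^sub>m d) * \<rho> x"
      using tw[OF that] cx mult_smult_distrib[OF cx one_carrier_mat, of "- c"]
        mult_smult_assoc_mat[OF one_carrier_mat cx, of "- c"] by simp
    also have "\<dots> = ?S * \<rho> x"
      unfolding S using cx T by (intro add_mult_distrib_mat[symmetric]) auto
    finally show ?thesis .
  qed
  ultimately have "?S = 0\<^sub>m d d"
    using schur_lemma(2)[OF rho rho Sc] by blast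
  then have z: "(T + (- c) \<cdot>\<^sub>m 1\<^sub>m d) $$ (i, j) = 0" if "i < d" "j < d" for i j
    using S that by simp
  have "T = c \<cdot>\<^sub>m 1\<^sub>m d"
  proof (rule eq_matI)
    fix i j assume "i < dim_row (c \<cdot>\<^sub>m 1\<^sub>m d)" "j < dim_col (c \<cdot>\<^sub>m 1\<^sub>m d)"
    then show "T $$ (i, j) = (c \<cdot>\<^sub>m 1\<^sub>m d) $$ (i, j)" using z[of i j] T by (auto split: if_splits)
  qed (use T in auto)
  then show ?thesis by (rule that)
qed

end

section \<open>Characters\<close>

lemma cinner_add: "cinner K (\<lambda>x. f x + h x) g = cinner K f g + cinner K h g"
  by (simp add: cinner_def algebra_simps sum.distrib add_divide_distrib)

lemma cinner_scale: "cinner K (\<lambda>x. c * f x) g = c * cinner K f g"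
  by (simp add: cinner_def sum_distrib_left algebra_simps)

lemma cinner_sum: "cinner K (\<lambda>x. \<Sum>i\<in>I. f i x) g = (\<Sum>i\<in>I. cinner K (f i) g)"
proof (induction I rule: infinite_finite_induct)
  case (insert i I)
  then show ?case by (simp add: cinner_add)
qed (simp_all add: cinner_def)

lemma cinner_res: "cinner K (res K f) g = cinner K f g" "cinner K f (res K g) = cinner K f g"
  by (simp_all add: cinner_def res_def)

lemma cinner_cnj: "cnj (cinner K f g) = cinner K g f"
  by (simp add: cinner_def mult.commute)

lemma sum_list_map_eq_sum_count_list:
  fixes f :: "'c \<Rightarrow> 'd :: semiring_1"
  assumes "finite X" "set xs \<subseteq> X"
  shows "(\<Sum>y\<leftarrow>xs. f y) = (\<Sum>y\<in>X. of_nat (count_list xs y) * f y)"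
  using assms(2)
proof (induction xs)
  case (Cons a xs)
  have "(\<Sum>y\<in>X. of_nat (count_list (a # xs) y) * f y)
      = (\<Sum>y\<in>X. (if y = a then f a else 0) + of_nat (count_list xs y) * f y)"
    by (rule sum.cong) (auto simp: algebra_simps)
  with Cons assms(1) show ?case by (simp add: sum.distrib)
qed simp

context finite_subgroup begin

lemma rep_mult_entry:
  assumes "mat_rep G K d \<rho>" "x \<in> K" "y \<in> K" "i < d" "j < d"
  shows "\<rho> (x \<otimes> y) $$ (i, j) = (\<Sum>l<d. \<rho> x $$ (i, l) * \<rho> y $$ (l, j))"
  using index_mult_mat_sum[OF rep_carrier[OF assms(1,2)] rep_carrier[OF assms(1,3)] assms(4,5)]
    rep_mult[OF assms(1-3)] by simp

section \<open>Values of irreducible characters at inverses and conjugates\<close>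

lemma mtrace_rep_inverse:
  assumes rep: "mat_rep G K d \<rho>" and h: "h \<in> K"
  shows "mtrace (\<rho> (inv h)) = cnj (mtrace (\<rho> h))"
proof -
  \<comment> \<open>The invariant Hermitian form intertwines the dual and the conjugate representation.\<close>
  define H where "H = mat d d (\<lambda>(i, j). \<Sum>g\<in>K. \<Sum>a<d. \<rho> g $$ (i, a) * cnj (\<rho> g $$ (j, a)))"
  define C where "C = mat d d (\<lambda>(i, j). cnj (\<rho> h $$ (j, i)))"
  have H: "H \<in> carrier_mat d d" and C: "C \<in> carrier_mat d d" by (auto simp: H_def C_def)
  note ri = rep_carrier[OF rep inv_K[OF h]]
  have tw: "\<rho> (inv h) * H = H * C"
  proof (rule eq_matI)
    fix i j assume "i < dim_row (H * C)" "j < dim_col (H * C)"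
    then have ij: "i < d" "j < d" using H C by auto
    have "(\<rho> (inv h) * H) $$ (i, j) = (\<Sum>l<d. \<rho> (inv h) $$ (i, l) * H $$ (l, j))"
      by (rule index_mult_mat_sum[OF ri H ij])
    also have "\<dots> = (\<Sum>l<d. \<Sum>g\<in>K. \<Sum>a<d. \<rho> (inv h) $$ (i, l) * \<rho> g $$ (l, a) * cnj (\<rho> g $$ (j, a)))"
      by (rule sum.cong) (use ij in \<open>auto simp: H_def sum_distrib_left mult.assoc\<close>)
    also have "\<dots> = (\<Sum>g\<in>K. \<Sum>a<d. \<Sum>l<d. \<rho> (inv h) $$ (i, l) * \<rho> g $$ (l, a) * cnj (\<rho> g $$ (j, a)))"
      by (subst sum.swap, rule sum.cong[OF refl], rule sum.swap)
    also have "\<dots> = (\<Sum>g\<in>K. \<Sum>a<d. \<rho> (inv h \<otimes> g) $$ (i, a) * cnj (\<rho> g $$ (j, a)))"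
      by (intro sum.cong refl) (use h ij in \<open>simp add: rep_mult_entry[OF rep] sum_distrib_right\<close>)
    also have "\<dots> = (\<Sum>g\<in>K. \<Sum>a<d. \<rho> (inv h \<otimes> (h \<otimes> g)) $$ (i, a) * cnj (\<rho> (h \<otimes> g) $$ (j, a)))"
      by (rule sum_left_translate[OF h, symmetric])
    also have "\<dots> = (\<Sum>g\<in>K. \<Sum>a<d. \<rho> g $$ (i, a) * cnj (\<Sum>l<d. \<rho> h $$ (j, l) * \<rho> g $$ (l, a)))"
      by (intro sum.cong refl) (use h ij in \<open>simp add: rep_mult_entry[OF rep h] m_assoc[symmetric]\<close>)
    also have "\<dots> = (\<Sum>g\<in>K. \<Sum>a<d. \<Sum>l<d. \<rho> g $$ (i, a) * cnj (\<rho> g $$ (l, a)) * cnj (\<rho> h $$ (j, l)))"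
      by (intro sum.cong refl) (simp add: sum_distrib_left algebra_simps)
    also have "\<dots> = (\<Sum>l<d. \<Sum>g\<in>K. \<Sum>a<d. \<rho> g $$ (i, a) * cnj (\<rho> g $$ (l, a)) * cnj (\<rho> h $$ (j, l)))"
      by (subst sum.swap[of _ K], rule sum.cong[OF refl], rule sum.swap)
    also have "\<dots> = (\<Sum>l<d. H $$ (i, l) * C $$ (l, j))"
      by (rule sum.cong) (use ij in \<open>auto simp: H_def C_def sum_distrib_right\<close>)
    also have "\<dots> = (H * C) $$ (i, j)" by (rule index_mult_mat_sum[OF H C ij, symmetric])
    finally show "(\<rho> (inv h) * H) $$ (i, j) = (H * C) $$ (i, j)" .
  qed (use ri H C in auto)
  \<comment> \<open>\<open>H\<close> is positive definite: the Hermitian form of \<open>H\<close> at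
    \<open>v\<close> is the sum of the squared moduli of \<open>q g a\<close>, and the summands with
    \<open>g = \<one>\<close> are those of the coordinates of \<open>v\<close>.\<close>
  have "v = 0\<^sub>v d" if v: "v \<in> carrier_vec d" and z: "H *\<^sub>v v = 0\<^sub>v d" for v
  proof -
    have s: "(\<Sum>j<d. H $$ (i, j) * v $ j) = 0" if "i < d" for i
    proof -
      have "(H *\<^sub>v v) $ i = (\<Sum>j<d. H $$ (i, j) * v $ j)"
        using that v H by (auto simp: scalar_prod_def atLeast0LessThan intro!: sum.cong)
      with z that show ?thesis by simp
    qed
    define q where "q g a = (\<Sum>j<d. v $ j * cnj (\<rho> g $$ (j, a)))" for g a
    have "0 = (\<Sum>i<d. cnj (v $ i) * (\<Sum>j<d. H $$ (i, j) * v $ j))" using s by simp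
    also have "\<dots> = (\<Sum>i<d. \<Sum>j<d. \<Sum>g\<in>K. \<Sum>a<d. cnj (v $ i) * \<rho> g $$ (i, a) * (v $ j * cnj (\<rho> g $$ (j, a))))"
      by (intro sum.cong refl) (auto simp: H_def sum_distrib_left sum_distrib_right algebra_simps intro!: sum.cong)
    also have "\<dots> = (\<Sum>i<d. \<Sum>g\<in>K. \<Sum>j<d. \<Sum>a<d. cnj (v $ i) * \<rho> g $$ (i, a) * (v $ j * cnj (\<rho> g $$ (j, a))))"
      by (rule sum.cong[OF refl], rule sum.swap)
    also have "\<dots> = (\<Sum>g\<in>K. \<Sum>i<d. \<Sum>a<d. \<Sum>j<d. cnj (v $ i) * \<rho> g $$ (i, a) * (v $ j * cnj (\<rho> g $$ (j, a))))"
      by (subst sum.swap, rule sum.cong[OF refl], rule sum.cong[OF refl], rule sum.swap)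
    also have "\<dots> = (\<Sum>g\<in>K. \<Sum>a<d. \<Sum>i<d. \<Sum>j<d. cnj (v $ i) * \<rho> g $$ (i, a) * (v $ j * cnj (\<rho> g $$ (j, a))))"
      by (rule sum.cong[OF refl], rule sum.swap)
    also have "\<dots> = (\<Sum>g\<in>K. \<Sum>a<d. cnj (q g a) * q g a)"
      unfolding q_def by (intro sum.cong refl) (simp add: sum_product)
    also have "\<dots> = of_real (\<Sum>g\<in>K. \<Sum>a<d. (cmod (q g a))\<^sup>2)"
      unfolding of_real_sum complex_norm_square by (simp add: mult.commute)
    finally have "(\<Sum>g\<in>K. \<Sum>a<d. (cmod (q g a))\<^sup>2) = 0" by (metis of_real_eq_0_iff)
    then have "(\<Sum>a<d. (cmod (q \<one> a))\<^sup>2) = 0"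
      using finite_K by (subst (asm) sum_nonneg_eq_0_iff) (auto intro!: sum_nonneg)
    then have q0: "q \<one> a = 0" if "a < d" for a
      using that by (subst (asm) sum_nonneg_eq_0_iff) auto
    have "v $ a = 0" if "a < d" for a
    proof -
      have "q \<one> a = (\<Sum>j<d. if j = a then v $ a else 0)"
        unfolding q_def rep_one[OF rep] by (rule sum.cong) (use that in auto)
      with q0[OF that] that show ?thesis by simp
    qed
    with v show ?thesis by auto
  qed
  then have "det H \<noteq> 0" using det_0_iff_vec_prod_zero[OF H] by blast
  then obtain H' where H': "H' \<in> carrier_mat d d" "H * H' = 1\<^sub>m d" "H' * H = 1\<^sub>m d"
    using det_nonzero_inverse[OF H] by metis
  have "H' * \<rho> (inv h) * H = H' * (\<rho> (inv h) * H)" using H' ri H by simp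
  also have "\<dots> = H' * H * C" unfolding tw by (rule assoc_mult_mat[OF H'(1) H C, symmetric])
  also have "\<dots> = C" unfolding H' using C by simp
  finally have "mtrace (\<rho> (inv h)) = mtrace C" using mtrace_similar[OF ri H H'(1,2)] by simp
  then show ?thesis
    using mtrace_carrier[OF C] mtrace_carrier[OF rep_carrier[OF rep h]] by (simp add: C_def)
qed

lemma IrrE:
  assumes "\<chi> \<in> Irr G K"
  obtains d \<rho> where "irreducible_rep G K d \<rho>" "mat_rep G K d \<rho>" "0 < d" "\<chi> = char_of K \<rho>"
    "\<And>x. x \<in> K \<Longrightarrow> \<chi> x = (\<Sum>i<d. \<rho> x $$ (i, i))" "\<chi> \<one> = of_nat d"
proof -
  from assms obtain d \<rho> where i: "irreducible_rep G K d \<rho>" and c: "\<chi> = char_of K \<rho>" by (auto simp: Irr_def)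
  then have r: "mat_rep G K d \<rho>" "0 < d" by (auto simp: irreducible_rep_def)
  have t: "\<chi> x = (\<Sum>i<d. \<rho> x $$ (i, i))" if "x \<in> K" for x
    using that mtrace_carrier[OF rep_carrier[OF r(1) that]] c by (simp add: char_of_def)
  from t[OF one_K] have "\<chi> \<one> = of_nat d" using rep_one[OF r(1)] by simp
  with i r c t show ?thesis using that by blast
qed

lemma Irr_outside: "\<chi> \<in> Irr G K \<Longrightarrow> x \<notin> K \<Longrightarrow> \<chi> x = 0"
  by (auto simp: Irr_def char_of_def)

lemma Irr_one_nonzero: "\<chi> \<in> Irr G K \<Longrightarrow> \<chi> \<one> \<noteq> 0"
  by (erule IrrE) simp

lemma Irr_inverse: "\<chi> \<in> Irr G K \<Longrightarrow> x \<in> K \<Longrightarrow> \<chi> (inv x) = cnj (\<chi> x)"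
  by (erule IrrE) (simp add: char_of_def mtrace_rep_inverse)

lemma Irr_conj:
  assumes "\<chi> \<in> Irr G K" "x \<in> K" "h \<in> K"
  shows "\<chi> (h \<otimes> x \<otimes> inv h) = \<chi> x"
proof -
  from assms(1) obtain d \<rho> where r: "mat_rep G K d \<rho>" and c: "\<chi> = char_of K \<rho>" by (rule IrrE) blast
  have "\<rho> (h \<otimes> x \<otimes> inv h) = \<rho> h * \<rho> x * \<rho> (inv h)"
    using assms by (simp add: rep_mult[OF r])
  then have "mtrace (\<rho> (h \<otimes> x \<otimes> inv h)) = mtrace (\<rho> x)"
    using mtrace_similar[OF rep_carrier[OF r assms(2)] rep_carrier[OF r inv_K[OF assms(3)]]
        rep_carrier[OF r assms(3)] rep_inverse(1)[OF r assms(3)]] by simp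
  then show ?thesis using assms c by (simp add: char_of_def)
qed

section \<open>Orthogonality relations\<close>

text \<open>\<open>T\<close> is the sum over \<open>g\<close> of
  \<open>\<rho> g * E * \<sigma> (inv g)\<close>, where \<open>E\<close> is the matrix unit at
  \<open>(a, b)\<close>. Translating the summation variable by \<open>h\<close> moves
  \<open>\<rho> h\<close> on the left to \<open>\<sigma> h\<close> on the right.\<close>

lemma averaged_intertwiner:
  assumes r: "mat_rep G K d \<rho>" and s: "mat_rep G K d' \<sigma>" and h: "h \<in> K" and a: "a < d" and b: "b < d'"
  defines "T \<equiv> mat d d' (\<lambda>(i, j). \<Sum>g\<in>K. \<rho> g $$ (i, a) * \<sigma> (inv g) $$ (b, j))"
  shows "\<rho> h * T = T * \<sigma> h"
proof (rule eq_matI)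
  have T: "T \<in> carrier_mat d d'" by (simp add: T_def)
  note c = rep_carrier[OF r h] rep_carrier[OF s h]
  fix i j assume "i < dim_row (T * \<sigma> h)" "j < dim_col (T * \<sigma> h)"
  then have ij: "i < d" "j < d'" using T c by auto
  have "(\<rho> h * T) $$ (i, j) = (\<Sum>l<d. \<rho> h $$ (i, l) * T $$ (l, j))"
    by (rule index_mult_mat_sum[OF c(1) T ij])
  also have "\<dots> = (\<Sum>l<d. \<Sum>g\<in>K. \<rho> h $$ (i, l) * \<rho> g $$ (l, a) * \<sigma> (inv g) $$ (b, j))"
    by (rule sum.cong) (use ij in \<open>auto simp: T_def sum_distrib_left mult.assoc\<close>)
  also have "\<dots> = (\<Sum>g\<in>K. \<Sum>l<d. \<rho> h $$ (i, l) * \<rho> g $$ (l, a) * \<sigma> (inv g) $$ (b, j))"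
    by (rule sum.swap)
  \<comment> \<open>Writing \<open>inv g\<close> as \<open>inv (h \<otimes> g) \<otimes> h\<close>
    makes the summand a function of \<open>h \<otimes> g\<close>.\<close>
  also have "\<dots> = (\<Sum>g\<in>K. \<rho> (h \<otimes> g) $$ (i, a) * \<sigma> (inv (h \<otimes> g) \<otimes> h) $$ (b, j))"
    by (intro sum.cong refl)
      (use h ij a in \<open>simp add: rep_mult_entry[OF r] sum_distrib_right inv_mult_group m_assoc\<close>)
  also have "\<dots> = (\<Sum>g\<in>K. \<rho> g $$ (i, a) * \<sigma> (inv g \<otimes> h) $$ (b, j))"
    by (rule sum_left_translate[OF h])
  also have "\<dots> = (\<Sum>g\<in>K. \<Sum>l<d'. \<rho> g $$ (i, a) * \<sigma> (inv g) $$ (b, l) * \<sigma> h $$ (l, j))"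
    by (intro sum.cong refl) (use h ij b in \<open>simp add: rep_mult_entry[OF s] sum_distrib_left mult.assoc\<close>)
  also have "\<dots> = (\<Sum>l<d'. \<Sum>g\<in>K. \<rho> g $$ (i, a) * \<sigma> (inv g) $$ (b, l) * \<sigma> h $$ (l, j))"
    by (rule sum.swap)
  also have "\<dots> = (\<Sum>l<d'. T $$ (i, l) * \<sigma> h $$ (l, j))"
    by (rule sum.cong) (use ij in \<open>auto simp: T_def sum_distrib_right\<close>)
  also have "\<dots> = (T * \<sigma> h) $$ (i, j)" by (rule index_mult_mat_sum[OF T c(2) ij, symmetric])
  finally show "(\<rho> h * T) $$ (i, j) = (T * \<sigma> h) $$ (i, j)" .
qed (use rep_carrier[OF r h] rep_carrier[OF s h] in \<open>auto simp: T_def\<close>)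

text \<open>Once both traces are expanded, every inner sum is an entry of an averaged intertwiner.
  Between representations with different characters this matrix is zero; from a representation to
  itself it is a scalar matrix whose scalar is found from its trace.\<close>

lemma Irr_orthogonality:
  assumes chi: "\<chi> \<in> Irr G K" and psi: "\<psi> \<in> Irr G K"
  shows "(\<Sum>g\<in>K. \<chi> g * \<psi> (inv g)) = (if \<chi> = \<psi> then of_nat (card K) else 0)"
proof -
  have exp: "(\<Sum>g\<in>K. \<chi> g * \<psi> (inv g)) = (\<Sum>i<d. \<Sum>j<d'. \<Sum>g\<in>K. \<rho> g $$ (i, i) * \<sigma> (inv g) $$ (j, j))"
    if "\<And>x. x \<in> K \<Longrightarrow> \<chi> x = (\<Sum>i<d. \<rho> x $$ (i, i))" "\<And>x. x \<in> K \<Longrightarrow> \<psi> x = (\<Sum>i<d'. \<sigma> x $$ (i, i))"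
    for d d' :: nat and \<rho> \<sigma> :: "'a \<Rightarrow> complex mat"
  proof -
    have "(\<Sum>g\<in>K. \<chi> g * \<psi> (inv g)) = (\<Sum>g\<in>K. \<Sum>i<d. \<Sum>j<d'. \<rho> g $$ (i, i) * \<sigma> (inv g) $$ (j, j))"
      by (rule sum.cong) (simp_all add: that sum_product)
    also have "\<dots> = (\<Sum>i<d. \<Sum>j<d'. \<Sum>g\<in>K. \<rho> g $$ (i, i) * \<sigma> (inv g) $$ (j, j))"
      by (subst sum.swap, rule sum.cong[OF refl], rule sum.swap)
    finally show ?thesis .
  qed
  from chi obtain d \<rho> where ri: "irreducible_rep G K d \<rho>" and r: "mat_rep G K d \<rho>" and d: "0 < d"
    and c: "\<chi> = char_of K \<rho>" and tr: "\<And>x. x \<in> K \<Longrightarrow> \<chi> x = (\<Sum>i<d. \<rho> x $$ (i, i))" by (rule IrrE) blast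
  show ?thesis
  proof (cases "\<chi> = \<psi>")
    case False
    from psi obtain d' \<sigma> where si: "irreducible_rep G K d' \<sigma>" and s: "mat_rep G K d' \<sigma>"
      and c': "\<psi> = char_of K \<sigma>" and ts: "\<And>x. x \<in> K \<Longrightarrow> \<psi> x = (\<Sum>i<d'. \<sigma> x $$ (i, i))" by (rule IrrE) blast
    have "(\<Sum>g\<in>K. \<rho> g $$ (i, i) * \<sigma> (inv g) $$ (j, j)) = 0" if ij: "i < d" "j < d'" for i j
    proof -
      let ?T = "mat d d' (\<lambda>(i', j'). \<Sum>g\<in>K. \<rho> g $$ (i', i) * \<sigma> (inv g) $$ (j, j'))"
      have T: "?T \<in> carrier_mat d d'" by simp
      note tw = averaged_intertwiner[OF r s _ ij]
      \<comment> \<open>A nonzero intertwiner would be invertible by Schur's lemma and would make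
        the two characters equal.\<close>
      have "?T = 0\<^sub>m d d'"
      proof (rule ccontr)
        assume nz: "?T \<noteq> 0\<^sub>m d d'"
        have dd: "d = d'" "det ?T \<noteq> 0" using schur_lemma[OF ri si T tw nz] by auto
        have "char_of K \<rho> = char_of K \<sigma>"
          using intertwined_char_of_eq[OF r _ _ dd(2) tw] s T dd(1) by simp
        with False c c' show False by simp
      qed
      then have "?T $$ (i, j) = 0" using ij by simp
      then show ?thesis using ij by simp
    qed
    then show ?thesis using exp[OF tr ts] False by simp
  next
    case True
    have e: "(\<Sum>g\<in>K. \<rho> g $$ (i, i) * \<rho> (inv g) $$ (j, j)) = (if i = j then of_nat (card K) / of_nat d else 0)"
      if ij: "i < d" "j < d" for i j
    proof -
      let ?T = "mat d d (\<lambda>(i', j'). \<Sum>g\<in>K. \<rho> g $$ (i', i) * \<rho> (inv g) $$ (j, j'))"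
      have T: "?T \<in> carrier_mat d d" by simp
      obtain c where Tc: "?T = c \<cdot>\<^sub>m 1\<^sub>m d"
        using schur_scalar[OF ri T averaged_intertwiner[OF r r _ ij]] by blast
      \<comment> \<open>The trace of \<open>?T\<close> is evaluated in two ways; in the second, the
        factors recombine to \<open>\<rho> (inv g \<otimes> g)\<close>, the identity matrix.\<close>
      have "c * of_nat d = (\<Sum>l<d. ?T $$ (l, l))" unfolding Tc by simp
      also have "\<dots> = (\<Sum>l<d. \<Sum>g\<in>K. \<rho> (inv g) $$ (j, l) * \<rho> g $$ (l, i))"
        by (rule sum.cong) (auto simp: mult.commute)
      also have "\<dots> = (\<Sum>g\<in>K. \<Sum>l<d. \<rho> (inv g) $$ (j, l) * \<rho> g $$ (l, i))" by (rule sum.swap)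
      also have "\<dots> = (\<Sum>g\<in>K. \<rho> (inv g \<otimes> g) $$ (j, i))"
        by (rule sum.cong) (use ij in \<open>simp_all add: rep_mult_entry[OF r, symmetric]\<close>)
      also have "\<dots> = (if i = j then of_nat (card K) else 0)"
        using ij rep_one[OF r] by simp
      finally have "c * of_nat d = (if i = j then of_nat (card K) else 0)" .
      then have "c = (if i = j then of_nat (card K) / of_nat d else 0)" if "i = j" using that d by (simp add: field_simps)
      moreover have "?T $$ (i, j) = (if i = j then c else 0)" unfolding Tc using ij by simp
      ultimately show ?thesis using ij by auto
    qed
    have "(\<Sum>g\<in>K. \<chi> g * \<chi> (inv g)) = (\<Sum>i<d. \<Sum>j<d. if i = j then of_nat (card K) / of_nat d else 0)"
      using exp[OF tr tr[unfolded True]] True e by auto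
    also have "\<dots> = of_nat (card K)" using d by simp
    finally show ?thesis using True by simp
  qed
qed

lemma Irr_orthonormal:
  "\<chi> \<in> Irr G K \<Longrightarrow> \<psi> \<in> Irr G K \<Longrightarrow> cinner K \<chi> \<psi> = (if \<chi> = \<psi> then 1 else 0)"
  using Irr_orthogonality[of \<chi> \<psi>] card_K by (simp add: cinner_def Irr_inverse)

section \<open>The regular representation and completeness of the irreducible characters\<close>

text \<open>The character of the regular representation is \<open>card K\<close> at
  \<open>\<one>\<close> and zero elsewhere. Pairing it with \<open>\<psi>\<close> shows that
  \<open>\<psi>\<close> occurs \<open>\<psi> \<one>\<close> times in its decomposition. This number
  is nonzero, so the finite list of constituents exhausts \<open>Irr G K\<close>.\<close>

lemma regular_decomposition:
  shows finite_Irr: "finite (Irr G K)"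
    and sum_degree_Irr: "x \<in> K \<Longrightarrow> (\<Sum>\<psi>\<in>Irr G K. \<psi> \<one> * \<psi> x) = (if x = \<one> then of_nat (card K) else 0)"
proof -
  obtain f where f: "bij_betw f {..<card K} K"
    using ex_bij_betw_nat_finite[OF finite_K] by (auto simp: atLeast0LessThan)
  let ?N = "card K"
  \<comment> \<open>The permutation matrix of left multiplication by \<open>x\<close>, with
    \<open>K\<close> enumerated by \<open>f\<close>.\<close>
  define R :: "'a \<Rightarrow> complex mat" where "R x = mat ?N ?N (\<lambda>(i, j). if f i = x \<otimes> f j then 1 else 0)" for x
  have fK: "f i \<in> K" if "i < ?N" for i using f that by (auto simp: bij_betw_def)
  have finj: "f i = f j \<longleftrightarrow> i = j" if "i < ?N" "j < ?N" for i j
    using f that by (auto simp: bij_betw_def inj_on_def)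
  have rep: "mat_rep G K ?N R"
  proof (rule mat_repI)
    show "R x \<in> carrier_mat ?N ?N" for x by (simp add: R_def)
    show "R \<one> = 1\<^sub>m ?N" by (rule eq_matI) (auto simp: R_def fK finj)
    show "R (x \<otimes> y) = R x * R y" if xy: "x \<in> K" "y \<in> K" for x y
    proof (rule eq_matI)
      fix i j assume "i < dim_row (R x * R y)" "j < dim_col (R x * R y)"
      then have ij: "i < ?N" "j < ?N" by (auto simp: R_def)
      obtain m where m: "m < ?N" "f m = y \<otimes> f j"
        using f xy fK[OF ij(2)] unfolding bij_betw_def by (metis imageE lessThan_iff mult_K)
      have "(R x * R y) $$ (i, j) = (\<Sum>l<?N. R x $$ (i, l) * R y $$ (l, j))"
        by (rule index_mult_mat_sum[OF _ _ ij]) (auto simp: R_def)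
      also have "\<dots> = (\<Sum>l<?N. if l = m then (if f i = x \<otimes> f m then 1 else 0) else 0)"
        by (rule sum.cong) (use ij m finj in \<open>auto simp: R_def m(2)[symmetric]\<close>)
      also have "\<dots> = (if f i = x \<otimes> f m then 1 else 0)" using m by simp
      also have "\<dots> = R (x \<otimes> y) $$ (i, j)"
        unfolding m using ij xy fK[OF ij(2)] by (simp add: R_def m_assoc)
      finally show "R (x \<otimes> y) $$ (i, j) = (R x * R y) $$ (i, j)" by simp
    qed (auto simp: R_def)
  qed
  have tr: "char_of K R x = (if x = \<one> then of_nat ?N else 0)" if "x \<in> K" for x
  proof -
    have "char_of K R x = (\<Sum>i<?N. if x = \<one> then 1 else 0)"
      unfolding char_of_def using that fK by (auto simp: mtrace_def R_def intro!: sum.cong)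
    then show ?thesis by simp
  qed
  from char_of_decomposition[OF rep] obtain cs where cs: "set cs \<subseteq> Irr G K"
    and dec: "char_of K R = (\<lambda>x. \<Sum>\<chi>\<leftarrow>cs. \<chi> x)" by blast
  have dec': "char_of K R x = (\<Sum>\<chi>\<in>set cs. of_nat (count_list cs \<chi>) * \<chi> x)" for x
    unfolding dec by (rule sum_list_map_eq_sum_count_list) simp_all
  have cnt: "\<psi> \<one> = of_nat (count_list cs \<psi>)" if psi: "\<psi> \<in> Irr G K" for \<psi>
  proof -
    have "(\<Sum>g\<in>K. char_of K R g * \<psi> (inv g)) = (\<Sum>g\<in>K. if g = \<one> then of_nat ?N * \<psi> \<one> else 0)"
      by (rule sum.cong) (auto simp: tr)
    also have "\<dots> = of_nat ?N * \<psi> \<one>" using finite_K by simp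
    finally have "of_nat ?N * \<psi> \<one> = (\<Sum>g\<in>K. char_of K R g * \<psi> (inv g))" by simp
    also have "\<dots> = (\<Sum>g\<in>K. \<Sum>\<chi>\<in>set cs. of_nat (count_list cs \<chi>) * (\<chi> g * \<psi> (inv g)))"
      unfolding dec' by (simp add: sum_distrib_right mult.assoc)
    also have "\<dots> = (\<Sum>\<chi>\<in>set cs. of_nat (count_list cs \<chi>) * (\<Sum>g\<in>K. \<chi> g * \<psi> (inv g)))"
      by (subst sum.swap) (simp add: sum_distrib_left)
    also have "\<dots> = (\<Sum>\<chi>\<in>set cs. if \<chi> = \<psi> then of_nat (count_list cs \<psi>) * of_nat ?N else 0)"
      by (rule sum.cong) (use cs psi in \<open>auto simp: Irr_orthogonality\<close>)
    also have "\<dots> = of_nat ?N * of_nat (count_list cs \<psi>)"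
      by (auto simp: count_list_0_iff)
    finally show ?thesis using card_K by simp
  qed
  have "\<psi> \<in> set cs" if "\<psi> \<in> Irr G K" for \<psi>
  proof (rule ccontr)
    assume "\<psi> \<notin> set cs"
    then have "count_list cs \<psi> = 0" by (simp add: count_list_0_iff)
    with cnt[OF that] Irr_one_nonzero[OF that] show False by simp
  qed
  with cs have Irr: "Irr G K = set cs" by blast
  show "finite (Irr G K)" by (simp add: Irr)
  show "(\<Sum>\<psi>\<in>Irr G K. \<psi> \<one> * \<psi> x) = (if x = \<one> then of_nat ?N else 0)" if "x \<in> K"
  proof -
    have "(\<Sum>\<psi>\<in>Irr G K. \<psi> \<one> * \<psi> x) = char_of K R x"
      unfolding dec' Irr by (rule sum.cong) (use cnt Irr in auto)
    with tr[OF that] show ?thesis by simp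
  qed
qed

text \<open>For a class function \<open>f\<close> the matrix sum of \<open>f g\<close> times
  \<open>\<rho> (inv g)\<close> commutes with the representation, hence is a scalar
  \<open>c\<close>. Its trace gives \<open>c * d = card K * cinner K f \<psi>\<close>; the factor
  \<open>\<psi> \<one>\<close> on the left is the degree \<open>d\<close>.\<close>

lemma class_function_convolution:
  assumes f: "\<And>g h. g \<in> K \<Longrightarrow> h \<in> K \<Longrightarrow> f (h \<otimes> g \<otimes> inv h) = f g" and psi: "\<psi> \<in> Irr G K" and x: "x \<in> K"
  shows "\<psi> \<one> * (\<Sum>g\<in>K. f g * \<psi> (inv g \<otimes> x)) = of_nat (card K) * cinner K f \<psi> * \<psi> x"
proof -
  from psi obtain d \<rho> where ri: "irreducible_rep G K d \<rho>" and r: "mat_rep G K d \<rho>" and d: "0 < d"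
    and tr: "\<And>x. x \<in> K \<Longrightarrow> \<psi> x = (\<Sum>i<d. \<rho> x $$ (i, i))" and p1: "\<psi> \<one> = of_nat d" by (rule IrrE) blast
  let ?T = "mat d d (\<lambda>(i, j). \<Sum>g\<in>K. f g * \<rho> (inv g) $$ (i, j))"
  have T: "?T \<in> carrier_mat d d" by simp
  have Tr: "(?T * \<rho> h) $$ (i, j) = (\<Sum>g\<in>K. f g * \<rho> (inv g \<otimes> h) $$ (i, j))"
    if h: "h \<in> K" and ij: "i < d" "j < d" for h i j
  proof -
    have "(?T * \<rho> h) $$ (i, j) = (\<Sum>l<d. ?T $$ (i, l) * \<rho> h $$ (l, j))"
      by (rule index_mult_mat_sum[OF T rep_carrier[OF r h] ij])
    also have "\<dots> = (\<Sum>l<d. \<Sum>g\<in>K. f g * (\<rho> (inv g) $$ (i, l) * \<rho> h $$ (l, j)))"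
      by (rule sum.cong) (use ij in \<open>auto simp: sum_distrib_right mult.assoc\<close>)
    also have "\<dots> = (\<Sum>g\<in>K. \<Sum>l<d. f g * (\<rho> (inv g) $$ (i, l) * \<rho> h $$ (l, j)))" by (rule sum.swap)
    also have "\<dots> = (\<Sum>g\<in>K. f g * \<rho> (inv g \<otimes> h) $$ (i, j))"
      by (rule sum.cong) (use ij h in \<open>auto simp: rep_mult_entry[OF r] sum_distrib_left\<close>)
    finally show ?thesis .
  qed
  have "\<rho> h * ?T = ?T * \<rho> h" if h: "h \<in> K" for h
  proof (rule eq_matI)
    note c = rep_carrier[OF r h]
    fix i j assume "i < dim_row (?T * \<rho> h)" "j < dim_col (?T * \<rho> h)"
    then have ij: "i < d" "j < d" using c by auto
    have "(\<rho> h * ?T) $$ (i, j) = (\<Sum>l<d. \<rho> h $$ (i, l) * ?T $$ (l, j))"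
      by (rule index_mult_mat_sum[OF c T ij])
    also have "\<dots> = (\<Sum>l<d. \<Sum>g\<in>K. f g * (\<rho> h $$ (i, l) * \<rho> (inv g) $$ (l, j)))"
      by (rule sum.cong) (use ij in \<open>auto simp: sum_distrib_left mult_ac\<close>)
    also have "\<dots> = (\<Sum>g\<in>K. \<Sum>l<d. f g * (\<rho> h $$ (i, l) * \<rho> (inv g) $$ (l, j)))" by (rule sum.swap)
    also have "\<dots> = (\<Sum>g\<in>K. f g * \<rho> (h \<otimes> inv g) $$ (i, j))"
      by (rule sum.cong) (use ij h in \<open>auto simp: rep_mult_entry[OF r] sum_distrib_left\<close>)
    \<comment> \<open>Invariance of \<open>f\<close> allows passing to the conjugate of
      \<open>g\<close>; the summand then depends on that conjugate alone, and two translations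
      replace it by \<open>g\<close>.\<close>
    also have "\<dots> = (\<Sum>g\<in>K. f (h \<otimes> g \<otimes> inv h) * \<rho> (inv (h \<otimes> g \<otimes> inv h) \<otimes> h) $$ (i, j))"
    proof (rule sum.cong)
      fix g assume g: "g \<in> K"
      have "inv (h \<otimes> g \<otimes> inv h) \<otimes> h = h \<otimes> inv g"
        using g h by (simp add: inv_mult_group m_assoc)
      then show "f g * \<rho> (h \<otimes> inv g) $$ (i, j)
          = f (h \<otimes> g \<otimes> inv h) * \<rho> (inv (h \<otimes> g \<otimes> inv h) \<otimes> h) $$ (i, j)"
        using f[OF g h] by simp
    qed simp
    also have "\<dots> = (\<Sum>g\<in>K. f (g \<otimes> inv h) * \<rho> (inv (g \<otimes> inv h) \<otimes> h) $$ (i, j))"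
      by (rule sum_left_translate[OF h])
    also have "\<dots> = (\<Sum>g\<in>K. f g * \<rho> (inv g \<otimes> h) $$ (i, j))"
      by (rule sum_right_translate[OF inv_K[OF h]])
    also have "\<dots> = (?T * \<rho> h) $$ (i, j)" using Tr[OF h ij] by simp
    finally show "(\<rho> h * ?T) $$ (i, j) = (?T * \<rho> h) $$ (i, j)" .
  qed (use rep_carrier[OF r h] in auto)
  then obtain c where Tc: "?T = c \<cdot>\<^sub>m 1\<^sub>m d" using schur_scalar[OF ri T] by blast
  \<comment> \<open>The trace of \<open>?T * \<rho> h\<close> is computed from the definition here
    and from the scalar form in \<open>cs\<close>. The choice \<open>h = \<one>\<close> determines
    \<open>c\<close>, and \<open>h = x\<close> gives the claim.\<close>
  have sw: "(\<Sum>i<d. (?T * \<rho> h) $$ (i, i)) = (\<Sum>g\<in>K. f g * \<psi> (inv g \<otimes> h))" if h: "h \<in> K" for h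
  proof -
    have "(\<Sum>i<d. (?T * \<rho> h) $$ (i, i)) = (\<Sum>i<d. \<Sum>g\<in>K. f g * \<rho> (inv g \<otimes> h) $$ (i, i))"
      by (rule sum.cong) (use Tr[OF h] in auto)
    also have "\<dots> = (\<Sum>g\<in>K. \<Sum>i<d. f g * \<rho> (inv g \<otimes> h) $$ (i, i))" by (rule sum.swap)
    also have "\<dots> = (\<Sum>g\<in>K. f g * \<psi> (inv g \<otimes> h))"
      by (rule sum.cong) (use h in \<open>auto simp: tr sum_distrib_left\<close>)
    finally show ?thesis .
  qed
  have cs: "(\<Sum>i<d. (?T * \<rho> h) $$ (i, i)) = c * \<psi> h" if h: "h \<in> K" for h
  proof -
    note ch = rep_carrier[OF r h]
    have "?T * \<rho> h = c \<cdot>\<^sub>m \<rho> h"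
      unfolding Tc using mult_smult_assoc_mat[OF one_carrier_mat ch, of c] ch by simp
    then show ?thesis using tr[OF h] ch by (simp add: sum_distrib_left)
  qed
  have "c * of_nat d = (\<Sum>g\<in>K. f g * \<psi> (inv g \<otimes> \<one>))"
    using sw[OF one_K] cs[OF one_K] p1 by simp
  also have "\<dots> = (\<Sum>g\<in>K. f g * cnj (\<psi> g))"
    by (rule sum.cong) (use Irr_inverse[OF psi] in auto)
  also have "\<dots> = of_nat (card K) * cinner K f \<psi>" using card_K by (simp add: cinner_def)
  finally have "c * of_nat d = of_nat (card K) * cinner K f \<psi>" .
  moreover have "(\<Sum>g\<in>K. f g * \<psi> (inv g \<otimes> x)) = c * \<psi> x" using sw[OF x] cs[OF x] by simp
  ultimately show ?thesis using p1 by (simp add: mult_ac)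
qed

text \<open>Completeness: the convolution identity is summed over all \<open>\<psi>\<close>, and the
  regular character, concentrated at \<open>\<one>\<close>, singles out the term
  \<open>g = x\<close>.\<close>

lemma class_function_expansion:
  assumes f: "\<And>g h. g \<in> K \<Longrightarrow> h \<in> K \<Longrightarrow> f (h \<otimes> g \<otimes> inv h) = f g"
    and out: "\<And>x. x \<notin> K \<Longrightarrow> f x = 0"
  shows "f = (\<lambda>x. \<Sum>\<psi>\<in>Irr G K. cinner K f \<psi> * \<psi> x)"
proof
  fix x
  show "f x = (\<Sum>\<psi>\<in>Irr G K. cinner K f \<psi> * \<psi> x)"
  proof (cases "x \<in> K")
    case True
    have "of_nat (card K) * (\<Sum>\<psi>\<in>Irr G K. cinner K f \<psi> * \<psi> x)
        = (\<Sum>\<psi>\<in>Irr G K. \<psi> \<one> * (\<Sum>g\<in>K. f g * \<psi> (inv g \<otimes> x)))"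
      unfolding sum_distrib_left[of "of_nat (card K)"]
      by (rule sum.cong) (simp_all add: class_function_convolution[OF f _ True])
    also have "\<dots> = (\<Sum>\<psi>\<in>Irr G K. \<Sum>g\<in>K. f g * (\<psi> \<one> * \<psi> (inv g \<otimes> x)))"
      by (simp add: sum_distrib_left mult_ac)
    also have "\<dots> = (\<Sum>g\<in>K. f g * (\<Sum>\<psi>\<in>Irr G K. \<psi> \<one> * \<psi> (inv g \<otimes> x)))"
      by (subst sum.swap) (simp add: sum_distrib_left)
    also have "\<dots> = (\<Sum>g\<in>K. if g = x then f x * of_nat (card K) else 0)"
    proof (rule sum.cong)
      fix g assume g: "g \<in> K"
      have "inv g \<otimes> x = \<one> \<longleftrightarrow> g = x"
        using g True by (metis carrier_K inv_K inv_solve_left one_closed r_one)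
      then show "f g * (\<Sum>\<psi>\<in>Irr G K. \<psi> \<one> * \<psi> (inv g \<otimes> x)) = (if g = x then f x * of_nat (card K) else 0)"
        using g True sum_degree_Irr[of "inv g \<otimes> x"] by simp
    qed simp
    also have "\<dots> = f x * of_nat (card K)" using finite_K True by simp
    finally show ?thesis using card_K by simp
  qed (simp add: out Irr_outside)
qed

end

section \<open>Last invariant factor\<close>

lemma is_SNF_last_dvd:
  assumes "is_SNF A S" "A \<in> carrier_mat p p" "i < p"
  shows "S $$ (i, i) dvd S $$ (p - 1, p - 1)"
proof -
  from assms have chain: "S $$ (j, j) dvd S $$ (Suc j, Suc j)" if "Suc j < p" for j
    using that unfolding is_SNF_def by auto
  have "S $$ (i, i) dvd S $$ (i + j, i + j)" if "i + j < p" for j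
    using that by (induction j) (auto intro: dvd_trans chain)
  from this[of "p - 1 - i"] assms(3) show ?thesis by simp
qed

text \<open>The determinant of the diagonal matrix \<open>S\<close> vanishes, so some diagonal entry
  is zero, and that entry divides the last one.\<close>

lemma is_SNF_last_eq_0:
  assumes snf: "is_SNF A S" and A: "A \<in> carrier_mat p p" and d: "det A = 0"
  shows "S $$ (p - 1, p - 1) = 0"
proof -
  from snf A obtain P Q where S: "S \<in> carrier_mat p p"
    and PQ: "P \<in> carrier_mat p p" "Q \<in> carrier_mat p p" "S = P * A * Q"
    and diag: "\<And>i j. i < p \<Longrightarrow> j < p \<Longrightarrow> i \<noteq> j \<Longrightarrow> S $$ (i, j) = 0"
    unfolding is_SNF_def by auto
  have "det S = 0" unfolding PQ(3) using PQ(1,2) A d det_mult[of "P * A" p Q] det_mult[of P p A] by simp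
  moreover have "upper_triangular S" using S diag by auto
  ultimately have "prod_list (diag_mat S) = 0" using det_upper_triangular[OF _ S] by simp
  then obtain i where "i < p" "S $$ (i, i) = 0"
    using S by (auto simp: prod_list_zero_iff diag_mat_def)
  then show ?thesis using is_SNF_last_dvd[OF snf A, of i] by simp
qed

text \<open>Multiplication by the adjugate replaces \<open>A\<close> by the nonzero integer
  \<open>det A\<close>, which cancels entrywise.\<close>

lemma int_mat_mult_left_cancel:
  fixes A :: "int mat"
  assumes A: "A \<in> carrier_mat p p" "det A \<noteq> 0" and X: "X \<in> carrier_mat p p" and Y: "Y \<in> carrier_mat p p"
    and eq: "A * X = A * Y"
  shows "X = Y"
proof (rule eq_matI)
  note adj = adj_mat[OF A(1)]
  have "det A \<cdot>\<^sub>m X = adj_mat A * (A * X)"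
    using assoc_mult_mat[OF adj(1) A(1) X] mult_smult_assoc_mat[OF one_carrier_mat X, of "det A"] adj(3) X by simp
  also have "\<dots> = det A \<cdot>\<^sub>m Y"
    unfolding eq using assoc_mult_mat[OF adj(1) A(1) Y] mult_smult_assoc_mat[OF one_carrier_mat Y, of "det A"] adj(3) Y by simp
  finally have e: "det A \<cdot>\<^sub>m X = det A \<cdot>\<^sub>m Y" .
  fix i j assume "i < dim_row Y" "j < dim_col Y"
  then show "X $$ (i, j) = Y $$ (i, j)"
    using arg_cong[OF e, of "\<lambda>M. M $$ (i, j)"] A(2) X Y by simp
qed (use X Y in auto)

text \<open>The last invariant factor \<open>m\<close> is the least positive integer for which \<open>m A\<inverse>\<close> is integral,
  so a primitive integral multiple \<open>M\<close> of \<open>A\<inverse>\<close> computes it.\<close>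
lemma is_SNF_last_eq:
  assumes snf: "is_SNF A S" and A: "A \<in> carrier_mat p p" and d: "det A \<noteq> 0"
    and M: "M \<in> carrier_mat p p" and AM: "A * M = c \<cdot>\<^sub>m 1\<^sub>m p"
    and ij: "i < p" "j < p" "\<bar>M $$ (i, j)\<bar> = 1"
  shows "\<bar>S $$ (p - 1, p - 1)\<bar> = \<bar>c\<bar>"
proof -
  from snf A obtain P Q where S: "S \<in> carrier_mat p p"
    and PQ: "P \<in> carrier_mat p p" "Q \<in> carrier_mat p p" "S = P * A * Q"
    and inv: "invertible_mat P" "invertible_mat Q"
    and diag: "\<And>i j. i < p \<Longrightarrow> j < p \<Longrightarrow> i \<noteq> j \<Longrightarrow> S $$ (i, j) = 0"
    unfolding is_SNF_def by auto
  have ex: "\<exists>Y. Y \<in> carrier_mat p p \<and> X * Y = 1\<^sub>m p \<and> Y * X = 1\<^sub>m p"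
    if "X \<in> carrier_mat p p" "invertible_mat X" for X :: "int mat"
  proof -
    from that obtain Y where Y: "X * Y = 1\<^sub>m p" "Y * X = 1\<^sub>m (dim_row Y)"
      by (auto simp: invertible_mat_def inverts_mat_def)
    then have "Y \<in> carrier_mat p p"
      using that by (metis carrier_matI carrier_matD index_mult_mat(2,3) index_one_mat(2,3))
    with Y show ?thesis by auto
  qed
  obtain P' where P': "P' \<in> carrier_mat p p" "P * P' = 1\<^sub>m p" "P' * P = 1\<^sub>m p" using ex[OF PQ(1) inv(1)] by blast
  obtain Q' where Q': "Q' \<in> carrier_mat p p" "Q * Q' = 1\<^sub>m p" "Q' * Q = 1\<^sub>m p" using ex[OF PQ(2) inv(2)] by blast
  define m where "m = S $$ (p - 1, p - 1)"
  have p: "p - 1 < p" using ij by simp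
  have Sx: "(S * X) $$ (i, j) = S $$ (i, i) * X $$ (i, j)" if "X \<in> carrier_mat p p" "i < p" "j < p" for X i j
  proof -
    have "(S * X) $$ (i, j) = (\<Sum>l<p. S $$ (i, l) * X $$ (l, j))"
      by (rule index_mult_mat_sum[OF S that])
    also have "\<dots> = (\<Sum>l<p. if l = i then S $$ (i, i) * X $$ (i, j) else 0)"
      by (rule sum.cong) (use diag that in auto)
    finally show ?thesis using that by simp
  qed
  have "m dvd c"
  proof -
    \<comment> \<open>Transporting \<open>A * M = c\<close> along the base changes gives
      \<open>S * ?X = c\<close>; the last diagonal entry of this equation shows the
      divisibility.\<close>
    let ?X = "Q' * M * P'"
    have X: "?X \<in> carrier_mat p p" using Q' M P' by simp
    have "S * ?X = P * A * (Q * Q') * M * P'"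
      unfolding PQ(3) using PQ(1,2) A Q' M P'(1) by (smt (verit) assoc_mult_mat mult_carrier_mat)
    also have "\<dots> = P * (A * M) * P'"
      unfolding Q' using PQ(1,2) A M P'(1) by (smt (verit) assoc_mult_mat mult_carrier_mat right_mult_one_mat)
    also have "P * (A * M) = c \<cdot>\<^sub>m P"
      unfolding AM using mult_smult_distrib[OF PQ(1) one_carrier_mat, of c] PQ(1) by simp
    also have "c \<cdot>\<^sub>m P * P' = c \<cdot>\<^sub>m 1\<^sub>m p"
      using mult_smult_assoc_mat[OF PQ(1) P'(1), of c] P'(2) by simp
    finally have "(S * ?X) $$ (p - 1, p - 1) = c" using p by simp
    with Sx[OF X p p] show ?thesis unfolding m_def by (metis dvd_triv_left)
  qed
  moreover have "c dvd m"
  proof -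
    \<comment> \<open>All diagonal entries of \<open>S\<close> divide \<open>m\<close>, so
      \<open>E\<close> is an exact integral version of \<open>m S\<inverse>\<close>, and
      \<open>?B\<close> below plays the role of \<open>m A\<inverse>\<close>.\<close>
    define E where "E = mat p p (\<lambda>(i, j). if i = j then m div S $$ (i, i) else 0)"
    have E: "E \<in> carrier_mat p p" by (simp add: E_def)
    have SE: "S * E = m \<cdot>\<^sub>m 1\<^sub>m p"
    proof (rule eq_matI)
      fix i j assume "i < dim_row (m \<cdot>\<^sub>m 1\<^sub>m p)" "j < dim_col (m \<cdot>\<^sub>m 1\<^sub>m p)"
      then show "(S * E) $$ (i, j) = (m \<cdot>\<^sub>m 1\<^sub>m p) $$ (i, j)"
        using Sx[OF E, of i j] is_SNF_last_dvd[OF snf A, of i] by (auto simp: E_def m_def)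
    qed (use S E in auto)
    let ?B = "Q * E * P"
    have B: "?B \<in> carrier_mat p p" using PQ E by simp
    have "A * ?B = P' * P * A * Q * E * P"
      unfolding P' using PQ(1,2) A E by (smt (verit) assoc_mult_mat mult_carrier_mat left_mult_one_mat)
    also have "\<dots> = P' * (S * E) * P"
      unfolding PQ(3) using PQ(1,2) A E P'(1) by (smt (verit) assoc_mult_mat mult_carrier_mat)
    also have "P' * (S * E) = m \<cdot>\<^sub>m P'"
      unfolding SE using mult_smult_distrib[OF P'(1) one_carrier_mat, of m] P'(1) by simp
    also have "m \<cdot>\<^sub>m P' * P = m \<cdot>\<^sub>m 1\<^sub>m p"
      using mult_smult_assoc_mat[OF P'(1) PQ(1), of m] P'(3) by simp
    finally have AB: "A * ?B = m \<cdot>\<^sub>m 1\<^sub>m p" .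
    \<comment> \<open>Both products equal \<open>c * m\<close> times the identity. After cancelling
      \<open>A\<close>, the entry of \<open>M\<close> with absolute value 1 yields
      \<open>c dvd m\<close>.\<close>
    have "A * (c \<cdot>\<^sub>m ?B) = A * (m \<cdot>\<^sub>m M)"
      using mult_smult_distrib[OF A B, of c] mult_smult_distrib[OF A M, of m] AB AM
      by (auto intro!: eq_matI)
    then have "c \<cdot>\<^sub>m ?B = m \<cdot>\<^sub>m M"
      using int_mat_mult_left_cancel[OF A d] B M by auto
    then have "(c \<cdot>\<^sub>m ?B) $$ (i, j) = (m \<cdot>\<^sub>m M) $$ (i, j)" by simp
    then have "c * ?B $$ (i, j) = m * M $$ (i, j)" using B M ij by (metis carrier_matD index_smult_mat(1))
    then have "c dvd m * M $$ (i, j)" by (metis dvd_triv_left)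
    with ij(3) show ?thesis by (auto simp: abs_if split: if_splits)
  qed
  ultimately show ?thesis unfolding m_def[symmetric] by (rule zdvd_antisym_abs)
qed

section \<open>Differential posets\<close>

text \<open>\<open>C n z x\<close> says that \<open>z\<close> of rank \<open>n + 1\<close> covers
  \<open>x\<close> of rank \<open>n\<close>. The two commutation assumptions are the entries of
  \<open>DU - UD = r\<close>, where the term \<open>UD\<close> is zero in rank 0.\<close>

locale differential_poset =
  fixes P :: "nat \<Rightarrow> 'c set" and C :: "nat \<Rightarrow> 'c \<Rightarrow> 'c \<Rightarrow> bool" and r :: int
  assumes finite_P: "finite (P n)"
    and bottom: "\<exists>b. P 0 = {b}"
    and has_lower_cover: "z \<in> P (Suc n) \<Longrightarrow> \<exists>x\<in>P n. C n z x"
    and commutation_0: "x \<in> P 0 \<Longrightarrow> y \<in> P 0 \<Longrightarrow>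
      (\<Sum>z\<in>P (Suc 0). of_bool (C 0 z x) * of_bool (C 0 z y)) = (if x = y then r else 0)"
    and commutation_Suc: "x \<in> P (Suc n) \<Longrightarrow> y \<in> P (Suc n) \<Longrightarrow>
      (\<Sum>z\<in>P (Suc (Suc n)). of_bool (C (Suc n) z x) * of_bool (C (Suc n) z y)) =
      (\<Sum>w\<in>P n. of_bool (C n x w) * of_bool (C n y w)) + (if x = y then r else 0)"
begin

section \<open>Integral multiples of the inverse of \<open>DU\<^sub>n + k\<close>\<close>

definition DU :: "nat \<Rightarrow> 'c \<Rightarrow> 'c \<Rightarrow> int" where
  "DU n x y = (\<Sum>z\<in>P (Suc n). of_bool (C n z x) * of_bool (C n z y))"

text \<open>The matrix equation \<open>(DU\<^sub>n + k) M = c\<close>, with matrices indexed by the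
  elements of \<open>P n\<close> themselves, so that the recursion involves no enumerations.\<close>

definition scaled_inverse :: "nat \<Rightarrow> int \<Rightarrow> ('c \<Rightarrow> 'c \<Rightarrow> int) \<Rightarrow> int \<Rightarrow> bool" where
  "scaled_inverse n k M c \<longleftrightarrow> (\<forall>x\<in>P n. \<forall>y\<in>P n.
     (\<Sum>z\<in>P n. (DU n x z + (if x = z then k else 0)) * M z y) = (if x = y then c else 0))"

text \<open>If \<open>(DU\<^sub>n + s) M = c\<close>, then \<open>(U D + s) (c - U M D) = s c\<close>, and \<open>DU\<^bsub>n+1\<^esub> = U D + r\<close>.\<close>
lemma scaled_inverse_Suc:
  assumes M: "scaled_inverse n (r + k) M c"
  shows "scaled_inverse (Suc n) k
    (\<lambda>x y. (if x = y then c else 0) - (\<Sum>v\<in>P n. \<Sum>w\<in>P n. of_bool (C n x v) * M v w * of_bool (C n y w)))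
    ((r + k) * c)"
  unfolding scaled_inverse_def
proof (intro ballI)
  fix x y assume x: "x \<in> P (Suc n)" and y: "y \<in> P (Suc n)"
  let ?u = "\<lambda>z w. of_bool (C n z w) :: int"
  let ?N = "\<lambda>z. \<Sum>v\<in>P n. \<Sum>w\<in>P n. ?u z v * M v w * ?u y w"
  define A where "A z = (\<Sum>v\<in>P n. ?u x v * ?u z v) + (if x = z then r + k else 0)" for z
  have Aeq: "DU (Suc n) x z + (if x = z then k else 0) = A z" if "z \<in> P (Suc n)" for z
    using commutation_Suc[OF x that] by (simp add: DU_def A_def)
  have MM: "(\<Sum>w\<in>P n. DU n v w * M w w') = (if v = w' then c else 0) - (r + k) * M v w'"
    if "v \<in> P n" "w' \<in> P n" for v w'
  proof -
    have "(\<Sum>w\<in>P n. (DU n v w + (if v = w then r + k else 0)) * M w w')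
        = (\<Sum>w\<in>P n. DU n v w * M w w') + (\<Sum>w\<in>P n. if w = v then (r + k) * M v w' else 0)"
      unfolding sum.distrib[symmetric] by (rule sum.cong) (auto simp: distrib_right)
    also have "\<dots> = (\<Sum>w\<in>P n. DU n v w * M w w') + (r + k) * M v w'" using that finite_P by simp
    finally show ?thesis using M that unfolding scaled_inverse_def by auto
  qed
  \<comment> \<open>\<open>?N\<close> is column \<open>y\<close> of \<open>U M D\<close>. In matrix
    form \<open>(U D) (U M D) = U (DU M) D\<close>, and \<open>MM\<close> evaluates the inner factor
    \<open>DU M\<close> as \<open>c - (r + k) M\<close>.\<close>
  have N: "(\<Sum>z\<in>P (Suc n). (\<Sum>v\<in>P n. ?u x v * ?u z v) * ?N z)
      = c * (\<Sum>v\<in>P n. ?u x v * ?u y v) - (r + k) * ?N x"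
  proof -
    have "(\<Sum>z\<in>P (Suc n). (\<Sum>v\<in>P n. ?u x v * ?u z v) * ?N z)
        = (\<Sum>z\<in>P (Suc n). \<Sum>v\<in>P n. \<Sum>w\<in>P n. \<Sum>w'\<in>P n. ?u x v * ?u y w' * (?u z v * ?u z w * M w w'))"
      by (rule sum.cong[OF refl], subst sum_product) (simp add: sum_distrib_left mult_ac)
    also have "\<dots> = (\<Sum>v\<in>P n. \<Sum>w\<in>P n. \<Sum>w'\<in>P n. \<Sum>z\<in>P (Suc n). ?u x v * ?u y w' * (?u z v * ?u z w * M w w'))"
      by (subst sum.swap[where A = "P (Suc n)"], rule sum.cong[OF refl],
          subst sum.swap[where A = "P (Suc n)"], rule sum.cong[OF refl], rule sum.swap)
    also have "\<dots> = (\<Sum>v\<in>P n. \<Sum>w\<in>P n. \<Sum>w'\<in>P n. ?u x v * ?u y w' * (DU n v w * M w w'))"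
      unfolding DU_def by (simp add: sum_distrib_left sum_distrib_right)
    also have "\<dots> = (\<Sum>v\<in>P n. \<Sum>w'\<in>P n. \<Sum>w\<in>P n. ?u x v * ?u y w' * (DU n v w * M w w'))"
      by (rule sum.cong[OF refl], rule sum.swap)
    also have "\<dots> = (\<Sum>v\<in>P n. \<Sum>w'\<in>P n. ?u x v * ?u y w' * ((if v = w' then c else 0) - (r + k) * M v w'))"
      by (intro sum.cong refl) (simp add: MM[symmetric] sum_distrib_left)
    also have "\<dots> = (\<Sum>v\<in>P n. \<Sum>w'\<in>P n. (if v = w' then c * (?u x v * ?u y v) else 0)
          - (r + k) * (?u x v * M v w' * ?u y w'))"
      by (intro sum.cong refl) (auto simp: algebra_simps)
    also have "\<dots> = (\<Sum>v\<in>P n. c * (?u x v * ?u y v)) - (r + k) * ?N x"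
      using finite_P by (simp only: sum_subtractf sum_distrib_left) simp
    finally show ?thesis by (simp only: sum_distrib_left)
  qed
  have "(\<Sum>z\<in>P (Suc n). (DU (Suc n) x z + (if x = z then k else 0)) * ((if z = y then c else 0) - ?N z))
      = (\<Sum>z\<in>P (Suc n). A z * ((if z = y then c else 0) - ?N z))"
    by (rule sum.cong) (simp_all add: Aeq)
  \<comment> \<open>Expansion of \<open>(U D + r + k) (c - U M D)\<close>; by \<open>N\<close> the
    terms in \<open>U M D\<close> and in \<open>c U D\<close> cancel, leaving
    \<open>(r + k) c\<close>.\<close>
  also have "\<dots> = (\<Sum>z\<in>P (Suc n). (if z = y then A y * c else 0)
      - (\<Sum>v\<in>P n. ?u x v * ?u z v) * ?N z - (if z = x then (r + k) * ?N x else 0))"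
    by (intro sum.cong refl) (auto simp: A_def algebra_simps)
  also have "\<dots> = A y * c - (\<Sum>z\<in>P (Suc n). (\<Sum>v\<in>P n. ?u x v * ?u z v) * ?N z) - (r + k) * ?N x"
    using x y finite_P by (simp only: sum_subtractf sum.delta finite_P if_True)
  also have "\<dots> = (if x = y then (r + k) * c else 0)"
    unfolding N by (auto simp: A_def algebra_simps)
  finally show "(\<Sum>z\<in>P (Suc n). (DU (Suc n) x z + (if x = z then k else 0)) * ((if z = y then c else 0) - ?N z))
      = (if x = y then (r + k) * c else 0)" .
qed

section \<open>Counting covers; chains of elements with a unique lower cover\<close>

definition down :: "nat \<Rightarrow> 'c \<Rightarrow> 'c set" where "down n z = {x \<in> P n. C n z x}"

definition up :: "nat \<Rightarrow> 'c \<Rightarrow> 'c set" where "up n x = {z \<in> P (Suc n). C n z x}"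

lemma sum_of_bool_up: "(\<Sum>z\<in>P (Suc n). of_bool (C n z x) * of_bool (C n z y)) = int (card (up n x \<inter> up n y))"
proof -
  have "(\<Sum>z\<in>P (Suc n). of_bool (C n z x) * of_bool (C n z y) :: int) = (\<Sum>z\<in>up n x \<inter> up n y. 1)"
    using finite_P by (intro sum.mono_neutral_cong_right) (auto simp: up_def)
  then show ?thesis by simp
qed

lemma sum_of_bool_down: "(\<Sum>w\<in>P n. of_bool (C n x w) * of_bool (C n y w)) = int (card (down n x \<inter> down n y))"
proof -
  have "(\<Sum>w\<in>P n. of_bool (C n x w) * of_bool (C n y w) :: int) = (\<Sum>z\<in>down n x \<inter> down n y. 1)"
    using finite_P by (intro sum.mono_neutral_cong_right) (auto simp: down_def)
  then show ?thesis by simp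
qed

lemma finite_up: "finite (up n x)"
  using finite_P by (auto simp: up_def)

lemma card_up_Suc:
  "x \<in> P (Suc n) \<Longrightarrow> y \<in> P (Suc n) \<Longrightarrow>
    int (card (up (Suc n) x \<inter> up (Suc n) y)) = int (card (down n x \<inter> down n y)) + (if x = y then r else 0)"
  using commutation_Suc[of x n y] unfolding sum_of_bool_up sum_of_bool_down .

lemma card_up_0: "x \<in> P 0 \<Longrightarrow> int (card (up 0 x)) = r"
  using commutation_0[of x x] unfolding sum_of_bool_up by simp

text \<open>Suppose every upper cover of \<open>x\<close> also covers some
  \<open>y \<noteq> x\<close>. Distinct elements have as many common upper covers as common lower
  covers, so \<open>y\<close> covers \<open>w\<close>, and each such \<open>y\<close> accounts for
  at most one upper cover of \<open>x\<close>. That allows at most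
  \<open>card (up n w) - 1 \<le> r\<close> upper covers, whereas \<open>x\<close> has
  \<open>r + 1\<close>.\<close>

lemma single_down_extend:
  assumes x: "x \<in> P (Suc n)" and w: "w \<in> P n" "down n x = {w}" and up: "int (card (up n w)) \<le> r + 1"
  obtains z where "z \<in> P (Suc (Suc n))" "down (Suc n) z = {x}"
proof (rule ccontr)
  assume none: "\<not> thesis"
  let ?Y = "up n w - {x}"
  have xw: "x \<in> up n w" using x w by (auto simp: up_def down_def)
  have "up (Suc n) x \<subseteq> (\<Union>y\<in>?Y. up (Suc n) x \<inter> up (Suc n) y)"
  proof
    fix z assume z: "z \<in> up (Suc n) x"
    then have "x \<in> down (Suc n) z" "z \<in> P (Suc (Suc n))" using x by (auto simp: up_def down_def)
    with none that obtain y where y: "y \<in> down (Suc n) z" "y \<noteq> x" by blast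
    then have yP: "y \<in> P (Suc n)" and zy: "z \<in> up (Suc n) y"
      using \<open>z \<in> P (Suc (Suc n))\<close> by (auto simp: up_def down_def)
    then have "card (up (Suc n) x \<inter> up (Suc n) y) > 0"
      using z finite_up by (auto simp: card_gt_0_iff)
    then have "card (down n x \<inter> down n y) > 0" using card_up_Suc[OF x yP] y by simp
    then have "w \<in> down n y" using w by (auto simp: card_gt_0_iff)
    then have "y \<in> up n w" using yP by (auto simp: up_def down_def)
    with y z zy show "z \<in> (\<Union>y\<in>?Y. up (Suc n) x \<inter> up (Suc n) y)" by auto
  qed
  then have "card (up (Suc n) x) \<le> card (\<Union>y\<in>?Y. up (Suc n) x \<inter> up (Suc n) y)"
    by (intro card_mono) (auto simp: finite_up)
  also have "\<dots> \<le> (\<Sum>y\<in>?Y. card (up (Suc n) x \<inter> up (Suc n) y))"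
    by (rule card_UN_le) (simp add: finite_up)
  also have "\<dots> \<le> (\<Sum>y\<in>?Y. 1)"
  proof (rule sum_mono)
    fix y assume y: "y \<in> ?Y"
    then have yP: "y \<in> P (Suc n)" by (auto simp: up_def)
    have "card (down n x \<inter> down n y) \<le> card {w}" by (rule card_mono) (auto simp: w)
    then show "card (up (Suc n) x \<inter> up (Suc n) y) \<le> 1" using card_up_Suc[OF x yP] y by auto
  qed
  also have "\<dots> = card (up n w) - 1" using xw finite_up by simp
  finally have "card (up (Suc n) x) \<le> card (up n w) - 1" .
  moreover have "card (up n w) > 0" using xw finite_up by (auto simp: card_gt_0_iff)
  moreover have "int (card (up (Suc n) x)) = r + 1" using card_up_Suc[OF x x] w by simp
  ultimately show False using up by linarith
qed

text \<open>The bound on upper covers is assumed only for the first element: any later one has a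
  unique lower cover and hence exactly \<open>r + 1\<close> upper covers, so the extension step can
  be iterated by dependent choice.\<close>

lemma single_down_chain:
  assumes x0: "x0 \<in> P m" "int (card (up m x0)) \<le> r + 1" and z0: "z0 \<in> P (Suc m)" "down m z0 = {x0}"
  obtains X where "X 0 = x0" "X (Suc 0) = z0" "\<And>n. X n \<in> P (m + n)" "\<And>n. down (m + n) (X (Suc n)) = {X n}"
proof -
  \<comment> \<open>The state consists of two consecutive elements of the chain; the last conjunct
    fixes the initial pair.\<close>
  define Q where "Q n p \<longleftrightarrow> fst p \<in> P (m + n) \<and> snd p \<in> P (Suc (m + n)) \<and> down (m + n) (snd p) = {fst p} \<and>
    int (card (up (m + n) (fst p))) \<le> r + 1 \<and> (n = 0 \<longrightarrow> p = (x0, z0))" for n p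
  have "\<exists>f. \<forall>n. Q n (f n) \<and> snd (f n) = fst (f (Suc n))"
  proof (rule dependent_nat_choice)
    show "\<exists>p. Q 0 p" using assms by (auto simp: Q_def)
    fix p n assume q: "Q n p"
    then obtain z where z: "z \<in> P (Suc (Suc (m + n)))" "down (Suc (m + n)) z = {snd p}"
      unfolding Q_def using single_down_extend[of "snd p" "m + n" "fst p"] by blast
    have "int (card (up (Suc (m + n)) (snd p))) = r + 1"
      using q card_up_Suc[of "snd p" "m + n" "snd p"] by (simp add: Q_def)
    with q z have "Q (Suc n) (snd p, z)" by (simp add: Q_def)
    then show "\<exists>p'. Q (Suc n) p' \<and> snd p = fst p'" by (intro exI[of _ "(snd p, z)"]) simp
  qed
  then obtain f where f: "\<And>n. Q n (f n)" "\<And>n. snd (f n) = fst (f (Suc n))" by blast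
  show ?thesis
  proof (rule that[of "\<lambda>n. fst (f n)"])
    show "fst (f 0) = x0" "fst (f (Suc 0)) = z0" using f(1)[of 0] f(2)[of 0] by (auto simp: Q_def)
    show "fst (f n) \<in> P (m + n)" "down (m + n) (fst (f (Suc n))) = {fst (f n)}" for n
      using f(1)[of n] f(2)[of n] by (auto simp: Q_def)
  qed
qed

text \<open>Two chains through elements with a unique lower cover that split immediately above rank \<open>m\<close>
  pick out a matrix entry of the scaled inverse which, by the recursion, only changes sign from rank to rank.\<close>
lemma scaled_inverse_unit_entry:
  assumes base: "\<And>k. scaled_inverse m k (\<lambda>_ _. 1) (c k)"
    and x0: "x0 \<in> P m" "int (card (up m x0)) \<le> r + 1"
    and y0: "y0 \<in> P (Suc m)" "down m y0 = {x0}" and z0: "z0 \<in> P (Suc m)" "down m z0 = {x0}"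
    and yz: "y0 \<noteq> z0"
  shows "\<exists>M. scaled_inverse (m + n) k M ((\<Prod>i\<in>{1..int n}. r * i + k) * c (k + int n * r)) \<and>
    (\<exists>y\<in>P (m + n). \<exists>z\<in>P (m + n). \<bar>M y z\<bar> = 1)"
proof -
  obtain Y where Y: "Y 0 = x0" "Y (Suc 0) = y0" "\<And>n. Y n \<in> P (m + n)" "\<And>n. down (m + n) (Y (Suc n)) = {Y n}"
    using single_down_chain[OF x0 y0] by metis
  obtain Z where Z: "Z 0 = x0" "Z (Suc 0) = z0" "\<And>n. Z n \<in> P (m + n)" "\<And>n. down (m + n) (Z (Suc n)) = {Z n}"
    using single_down_chain[OF x0 z0] by metis
  \<comment> \<open>An element of a chain determines its predecessor, so chains that have split
    never meet again.\<close>
  have ne: "Y (Suc n) \<noteq> Z (Suc n)" for n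
  proof (induction n)
    case (Suc n)
    show ?case
    proof
      assume "Y (Suc (Suc n)) = Z (Suc (Suc n))"
      then have "{Y (Suc n)} = {Z (Suc n)}" using Y(4)[of "Suc n"] Z(4)[of "Suc n"] by simp
      with Suc show False by simp
    qed
  qed (use Y Z yz in simp)
  have "\<exists>M. scaled_inverse (m + n) k M ((\<Prod>i\<in>{1..int n}. r * i + k) * c (k + int n * r)) \<and> \<bar>M (Y n) (Z n)\<bar> = 1"
  proof (induction n arbitrary: k)
    case 0
    show ?case using base[of k] by (intro exI[of _ "\<lambda>_ _. 1"]) simp
  next
    case (Suc n)
    \<comment> \<open>Going up one rank lowers the parameter from \<open>r + k\<close> to
      \<open>k\<close>, so the induction must range over all \<open>k\<close>.\<close>
    from Suc.IH[of "r + k"] obtain M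
      where M: "scaled_inverse (m + n) (r + k) M ((\<Prod>i\<in>{1..int n}. r * i + (r + k)) * c (r + k + int n * r))"
        and u: "\<bar>M (Y n) (Z n)\<bar> = 1" by blast
    let ?P = "P (m + n)"
    let ?c = "(\<Prod>i\<in>{1..int n}. r * i + (r + k)) * c (r + k + int n * r)"
    let ?M = "\<lambda>x y. (if x = y then ?c else 0) - (\<Sum>v\<in>?P. \<Sum>w\<in>?P. of_bool (C (m + n) x v) * M v w * of_bool (C (m + n) y w))"
    have inv: "scaled_inverse (Suc (m + n)) k ?M ((r + k) * ?c)" by (rule scaled_inverse_Suc[OF M])
    \<comment> \<open>Splitting off the factor for 1 and shifting the index turns the remaining
      product into the one for the parameter \<open>r + k\<close>.\<close>
    have "{1..int (Suc n)} = insert 1 {2..int n + 1}" by auto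
    then have "(\<Prod>i\<in>{1..int (Suc n)}. r * i + k) = (r + k) * (\<Prod>i\<in>{2..int n + 1}. r * i + k)"
      by simp
    also have "(\<Prod>i\<in>{2..int n + 1}. r * i + k) = (\<Prod>i\<in>{1..int n}. r * (i + 1) + k)"
      by (rule prod.reindex_bij_witness[of _ "\<lambda>i. i + 1" "\<lambda>i. i - 1"]) auto
    also have "\<dots> = (\<Prod>i\<in>{1..int n}. r * i + (r + k))"
      by (simp add: algebra_simps)
    finally have "(r + k) * ?c = (\<Prod>i\<in>{1..int (Suc n)}. r * i + k) * c (k + int (Suc n) * r)"
      by (simp add: algebra_simps)
    \<comment> \<open>The diagonal term is absent because the chains are disjoint here, and the
      unique lower covers reduce the double sum to one entry of \<open>M\<close>.\<close>
    moreover have "?M (Y (Suc n)) (Z (Suc n)) = - M (Y n) (Z n)"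
    proof -
      have "C (m + n) (Y (Suc n)) v \<longleftrightarrow> v = Y n" "C (m + n) (Z (Suc n)) v \<longleftrightarrow> v = Z n" if "v \<in> ?P" for v
        using Y(4)[of n] Z(4)[of n] that by (auto simp: down_def)
      then have "(\<Sum>v\<in>?P. \<Sum>w\<in>?P. of_bool (C (m + n) (Y (Suc n)) v) * M v w * of_bool (C (m + n) (Z (Suc n)) w))
          = (\<Sum>v\<in>?P. \<Sum>w\<in>?P. if w = Z n then (if v = Y n then M v w else 0) else 0)"
        by (intro sum.cong refl) auto
      also have "\<dots> = M (Y n) (Z n)" using Y(3) Z(3) finite_P by simp
      finally show ?thesis using ne[of n] by simp
    qed
    ultimately show ?case using inv u by (intro exI[of _ ?M]) simp
  qed
  then show ?thesis using Y(3) Z(3) by blast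
qed

text \<open>For \<open>r \<ge> 2\<close> the bottom element has two upper covers, from which the
  chains start. For \<open>r = 1\<close> it has only one; the chains split above the single element
  of rank 1 instead. Starting there with \<open>2 + k\<close> rather than
  \<open>(1 + k) * (2 + k)\<close> removes, after the shift of \<open>k\<close>, the factor
  \<open>int n + k\<close>.\<close>

lemma scaled_inverse_exists:
  assumes "r \<ge> 2 \<and> c = (\<Prod>i\<in>{1..int n + 1}. r * i + k)
    \<or> r = 1 \<and> c = (\<Prod>i\<in>{1..int n - 1}. 1 * i + k) * (int n + 1 + k)"
  shows "\<exists>M. scaled_inverse n k M c \<and> (\<exists>y\<in>P n. \<exists>z\<in>P n. \<bar>M y z\<bar> = 1)"
proof -
  obtain b where b: "P 0 = {b}" using bottom by blast
  have up0: "int (card (up 0 b)) = r" using card_up_0 b by simp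
  \<comment> \<open>\<open>DU\<^sub>0 + k\<close> is the one by one matrix with entry
    \<open>r + k\<close>.\<close>
  have base0: "scaled_inverse 0 k (\<lambda>_ _. 1) (r + k)" for k
    using commutation_0[of b b] b by (simp add: scaled_inverse_def DU_def)
  have d0: "z \<in> P (Suc 0) \<and> down 0 z = {b}" if "z \<in> up 0 b" for z
    using that b by (auto simp: up_def down_def)
  have P1: "P (Suc 0) = up 0 b" using has_lower_cover[of _ 0] b by (auto simp: up_def)
  show ?thesis
  proof (cases "r \<ge> 2")
    case True
    then have "\<not> card (up 0 b) \<le> 1" using up0 by linarith
    then obtain y z where yz: "y \<in> up 0 b" "z \<in> up 0 b" "y \<noteq> z"
      by (metis card_le_Suc0_iff_eq finite_up One_nat_def)
    \<comment> \<open>The largest factor is the base value at the shifted parameter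
      \<open>k + int n * r\<close>.\<close>
    have "{1..int n + 1} = insert (int n + 1) {1..int n}" by auto
    then have "(\<Prod>i\<in>{1..int n + 1}. r * i + k) = (\<Prod>i\<in>{1..int n}. r * i + k) * (r + (k + int n * r))"
      by (simp add: algebra_simps)
    then show ?thesis
      using scaled_inverse_unit_entry[OF base0, of b y z n k] d0 yz up0 b assms True by simp
  next
    case False
    with assms have r: "r = 1" and c: "c = (\<Prod>i\<in>{1..int n - 1}. 1 * i + k) * (int n + 1 + k)" by auto
    show ?thesis
    proof (cases n)
      case 0
      \<comment> \<open>The product over \<open>{1..-1}\<close> is empty, so \<open>c\<close> is
        \<open>1 + k\<close>, the base value for \<open>r = 1\<close>.\<close>
      with base0[of k] b c r show ?thesis by (intro exI[of _ "\<lambda>_ _. 1"]) simp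
    next
      case (Suc n')
      from up0 r P1 obtain x where x: "P (Suc 0) = {x}" by (auto simp: card_1_singleton_iff)
      then have dx: "down 0 x = {b}" using d0 P1 by auto
      have upx: "int (card (up (Suc 0) x)) = 2" using card_up_Suc[of x 0 x] x dx r by simp
      \<comment> \<open>The only entry of \<open>DU\<^sub>1\<close> is 2: one lower cover plus
        \<open>r = 1\<close>.\<close>
      have base1: "scaled_inverse (Suc 0) k (\<lambda>_ _. 1) (2 + k)" for k
        using commutation_Suc[of x 0 x] x r unfolding sum_of_bool_down
        by (simp add: scaled_inverse_def DU_def dx)
      from upx have "\<not> card (up (Suc 0) x) \<le> 1" by linarith
      then obtain y z where yz: "y \<in> up (Suc 0) x" "z \<in> up (Suc 0) x" "y \<noteq> z"
        by (metis card_le_Suc0_iff_eq finite_up One_nat_def)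
      then have "y \<in> P (Suc (Suc 0)) \<and> down (Suc 0) y = {x}" "z \<in> P (Suc (Suc 0)) \<and> down (Suc 0) z = {x}"
        using x by (auto simp: up_def down_def)
      moreover have "c = (\<Prod>i\<in>{1..int n'}. r * i + k) * (2 + (k + int n' * r))"
        using c Suc r by simp
      ultimately show ?thesis
        using scaled_inverse_unit_entry[OF base1, of x y z n' k] yz upx x r Suc by simp
    qed
  qed
qed

end

section \<open>Differential towers\<close>

text \<open>Invariance of \<open>g\<close> lets both factors be evaluated at the conjugate of
  \<open>y\<close>. Translation then makes the inner sum independent of \<open>x\<close>, and the
  resulting factor \<open>card L\<close> cancels.\<close>

lemma frobenius_reciprocity:
  fixes G (structure)
  assumes "finite_subgroup G K" "finite_subgroup G L" and KL: "K \<subseteq> L"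
    and g: "\<And>x h. x \<in> L \<Longrightarrow> h \<in> L \<Longrightarrow> g (h \<otimes> x \<otimes> inv h) = g x"
  shows "cinner L (ind G K L f) g = cinner K f (res K g)"
proof -
  interpret K: finite_subgroup G K by fact
  interpret L: finite_subgroup G L by fact
  have "(\<Sum>y\<in>L. (\<Sum>x\<in>L. res K f (x \<otimes> y \<otimes> inv x)) * cnj (g y))
      = (\<Sum>y\<in>L. \<Sum>x\<in>L. res K f (x \<otimes> y \<otimes> inv x) * cnj (g (x \<otimes> y \<otimes> inv x)))"
    by (rule sum.cong) (simp_all add: sum_distrib_right g)
  also have "\<dots> = (\<Sum>x\<in>L. \<Sum>y\<in>L. res K f (x \<otimes> y \<otimes> inv x) * cnj (g (x \<otimes> y \<otimes> inv x)))"
    by (rule sum.swap)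
  also have "\<dots> = (\<Sum>x\<in>L. \<Sum>y\<in>L. res K f y * cnj (g y))"
  proof (rule sum.cong)
    fix x assume x: "x \<in> L"
    have "(\<Sum>y\<in>L. res K f (x \<otimes> y \<otimes> inv x) * cnj (g (x \<otimes> y \<otimes> inv x)))
        = (\<Sum>y\<in>L. res K f (y \<otimes> inv x) * cnj (g (y \<otimes> inv x)))"
      by (rule L.sum_left_translate[OF x])
    also have "\<dots> = (\<Sum>y\<in>L. res K f y * cnj (g y))"
      by (rule L.sum_right_translate[OF L.inv_K[OF x]])
    finally show "(\<Sum>y\<in>L. res K f (x \<otimes> y \<otimes> inv x) * cnj (g (x \<otimes> y \<otimes> inv x)))
        = (\<Sum>y\<in>L. res K f y * cnj (g y))" .
  qed simp
  also have "(\<Sum>y\<in>L. res K f y * cnj (g y)) = (\<Sum>y\<in>K. f y * cnj (res K g y))"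
    using KL L.finite_K by (intro sum.mono_neutral_cong_right) (auto simp: res_def)
  finally have "(\<Sum>y\<in>L. (\<Sum>x\<in>L. res K f (x \<otimes> y \<otimes> inv x)) * cnj (g y))
      = of_nat (card L) * (\<Sum>y\<in>K. f y * cnj (res K g y))" by simp
  then show ?thesis
    using L.card_K by (simp add: cinner_def ind_def sum_divide_distrib[symmetric] field_simps)
qed

lemma ind_class_function:
  fixes G (structure)
  assumes "finite_subgroup G L" and g: "g \<in> L" and h: "h \<in> L"
  shows "ind G K L f (h \<otimes> g \<otimes> inv h) = ind G K L f g"
proof -
  interpret L: finite_subgroup G L by fact
  have "(\<Sum>x\<in>L. res K f (x \<otimes> (h \<otimes> g \<otimes> inv h) \<otimes> inv x)) = (\<Sum>x\<in>L. res K f ((x \<otimes> h) \<otimes> g \<otimes> inv (x \<otimes> h)))"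
    by (rule sum.cong) (use g h in \<open>auto simp: L.m_assoc L.inv_mult_group\<close>)
  also have "\<dots> = (\<Sum>x\<in>L. res K f (x \<otimes> g \<otimes> inv x))"
    by (rule L.sum_right_translate[OF h])
  finally show ?thesis using g h by (simp add: ind_def)
qed

lemma differential_tower_finite_subgroup:
  assumes "differential_tower G H r"
  shows "finite_subgroup G (H n)"
  using assms unfolding differential_tower_def finite_subgroup_def finite_subgroup_axioms_def by auto

section \<open>The differential poset of a tower\<close>

text \<open>Multiplicity-freeness makes the coefficients of restrictions, and by Frobenius
  reciprocity those of inductions, equal to the 0/1 cover relation. Pairing the tower relation for
  an irreducible \<open>x\<close> with an irreducible \<open>y\<close> then gives the commutation
  relations.\<close>

lemma differential_tower_poset:
  fixes G :: "('a, 'b) monoid_scheme" (structure)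
  assumes tower: "differential_tower G H r"
  shows "differential_poset (\<lambda>n. Irr G (H n)) (covers G H) r"
proof -
  note fs = differential_tower_finite_subgroup[OF tower]
  have rel: "res (H n) (ind G (H n) (H (Suc n)) f) x
      - (if n = 0 then 0 else ind G (H (n - 1)) (H n) (res (H (n - 1)) f) x) = of_int r * f x"
    if "vchar G (H n) f" for n f x
    using tower that unfolding differential_tower_def by meson
  have sub: "H n \<subseteq> H (Suc n)" and H0: "H 0 = {\<one>}"
    and mf: "\<psi> \<in> Irr G (H (Suc n)) \<Longrightarrow> \<chi> \<in> Irr G (H n) \<Longrightarrow> cinner (H n) (res (H n) \<psi>) \<chi> \<in> {0, 1}" for n \<psi> \<chi>
    using tower unfolding differential_tower_def by auto
  have c: "cinner (H n) (res (H n) \<psi>) \<chi> = of_bool (covers G H n \<psi> \<chi>)"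
    if "\<psi> \<in> Irr G (H (Suc n))" "\<chi> \<in> Irr G (H n)" for n \<psi> \<chi>
    using mf[OF that] that by (auto simp: covers_def)
  have c': "cinner (H n) \<chi> (res (H n) \<psi>) = of_bool (covers G H n \<psi> \<chi>)"
    if "\<psi> \<in> Irr G (H (Suc n))" "\<chi> \<in> Irr G (H n)" for n \<psi> \<chi>
    using c[OF that] cinner_cnj[of "H n" "res (H n) \<psi>" \<chi>] by (cases "covers G H n \<psi> \<chi>") auto
  have res_exp: "res (H n) \<psi> = (\<lambda>x. \<Sum>\<chi>\<in>Irr G (H n). of_bool (covers G H n \<psi> \<chi>) * \<chi> x)"
    if psi: "\<psi> \<in> Irr G (H (Suc n))" for n \<psi>
  proof -
    interpret K: finite_subgroup G "H n" by (rule fs)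
    interpret L: finite_subgroup G "H (Suc n)" by (rule fs)
    have "res (H n) \<psi> = (\<lambda>x. \<Sum>\<chi>\<in>Irr G (H n). cinner (H n) (res (H n) \<psi>) \<chi> * \<chi> x)"
    proof (rule K.class_function_expansion)
      show "res (H n) \<psi> (h \<otimes> g \<otimes> inv h) = res (H n) \<psi> g" if "g \<in> H n" "h \<in> H n" for g h
        using that sub[of n] L.Irr_conj[OF psi, of g h] by (auto simp: res_def)
    qed (simp add: res_def)
    also have "\<dots> = (\<lambda>x. \<Sum>\<chi>\<in>Irr G (H n). of_bool (covers G H n \<psi> \<chi>) * \<chi> x)"
      using c[OF psi] by simp
    finally show ?thesis .
  qed
  have frob: "cinner (H (Suc n)) (ind G (H n) (H (Suc n)) f) \<psi> = cinner (H n) f (res (H n) \<psi>)"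
    if "\<psi> \<in> Irr G (H (Suc n))" for n f \<psi>
    using frobenius_reciprocity[OF fs fs sub] finite_subgroup.Irr_conj[OF fs that] by blast
  have up: "cinner (H n) (res (H n) (ind G (H n) (H (Suc n)) x)) y
      = (\<Sum>z\<in>Irr G (H (Suc n)). of_bool (covers G H n z x) * of_bool (covers G H n z y))"
    if x: "x \<in> Irr G (H n)" and y: "y \<in> Irr G (H n)" for n x y
  proof -
    interpret L: finite_subgroup G "H (Suc n)" by (rule fs)
    let ?I = "ind G (H n) (H (Suc n)) x"
    have "?I = (\<lambda>g. \<Sum>z\<in>Irr G (H (Suc n)). cinner (H (Suc n)) ?I z * z g)"
    proof (rule L.class_function_expansion)
      show "?I (h \<otimes> g \<otimes> inv h) = ?I g" if "g \<in> H (Suc n)" "h \<in> H (Suc n)" for g h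
        using ind_class_function[OF fs that] .
    qed (simp add: ind_def)
    also have "\<dots> = (\<lambda>g. \<Sum>z\<in>Irr G (H (Suc n)). of_bool (covers G H n z x) * z g)"
      using frob c'[OF _ x] by simp
    finally have I: "?I = (\<lambda>g. \<Sum>z\<in>Irr G (H (Suc n)). of_bool (covers G H n z x) * z g)" .
    have "cinner (H n) (res (H n) ?I) y = (\<Sum>z\<in>Irr G (H (Suc n)). of_bool (covers G H n z x) * cinner (H n) z y)"
      unfolding cinner_res I cinner_sum cinner_scale ..
    also have "\<dots> = (\<Sum>z\<in>Irr G (H (Suc n)). of_bool (covers G H n z x) * of_bool (covers G H n z y))"
      using c[OF _ y] by (simp add: cinner_res)
    finally show ?thesis .
  qed
  have down: "cinner (H (Suc n)) (ind G (H n) (H (Suc n)) (res (H n) x)) y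
      = (\<Sum>w\<in>Irr G (H n). of_bool (covers G H n x w) * of_bool (covers G H n y w))"
    if x: "x \<in> Irr G (H (Suc n))" and y: "y \<in> Irr G (H (Suc n))" for n x y
    unfolding frob[OF y] res_exp[OF x] cinner_sum cinner_scale using c'[OF y] by simp
  have irr_vchar: "vchar G (H n) x" if "x \<in> Irr G (H n)" for n x
  proof -
    have fin: "finite (Irr G (H n))" by (rule finite_subgroup.finite_Irr[OF fs])
    have "(\<Sum>\<psi>\<in>Irr G (H n). of_int (of_bool (\<psi> = x)) * \<psi> g) = (\<Sum>\<psi>\<in>Irr G (H n). if \<psi> = x then x g else 0)" for g
      by (rule sum.cong) auto
    then have "x = (\<lambda>g. \<Sum>\<psi>\<in>Irr G (H n). of_int (of_bool (\<psi> = x)) * \<psi> g)"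
      using fin that by simp
    then show ?thesis unfolding vchar_def by (rule exI[of _ "\<lambda>\<psi>. of_bool (\<psi> = x)"])
  qed
  have on: "cinner (H n) (\<lambda>g. of_int r * x g) y = (if x = y then of_int r else 0)"
    if "x \<in> Irr G (H n)" "y \<in> Irr G (H n)" for n x y
    unfolding cinner_scale using finite_subgroup.Irr_orthonormal[OF fs that] by simp
  show ?thesis
  proof
    show "finite (Irr G (H n))" for n by (rule finite_subgroup.finite_Irr[OF fs])
    interpret K: finite_subgroup G "H 0" by (rule fs)
    \<comment> \<open>Over the trivial group the inner product is a single product of nonzero
      degrees, so no two irreducible characters are orthogonal.\<close>
    show "\<exists>b. Irr G (H 0) = {b}"
    proof -
      have "Irr G (H 0) \<noteq> {}"
        using K.sum_degree_Irr[of \<one>] K.card_K by auto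
      moreover have "x = y" if "x \<in> Irr G (H 0)" "y \<in> Irr G (H 0)" for x y
        using K.Irr_orthonormal[OF that] K.Irr_one_nonzero[OF that(1)] K.Irr_one_nonzero[OF that(2)] H0
        by (auto simp: cinner_def split: if_splits)
      ultimately have "\<exists>!b. b \<in> Irr G (H 0)" by blast
      then show ?thesis by (metis is_singletonI' is_singleton_def empty_iff)
    qed
    \<comment> \<open>Without constituents the restriction of \<open>z\<close> would vanish at
      \<open>\<one>\<close>, where its value is the nonzero degree.\<close>
    show "\<exists>x\<in>Irr G (H n). covers G H n z x" if z: "z \<in> Irr G (H (Suc n))" for n z
    proof (rule ccontr)
      assume "\<not> ?thesis"
      then have "res (H n) z \<one> = 0" unfolding res_exp[OF z] by simp
      then show False
        using finite_subgroup.Irr_one_nonzero[OF fs z] finite_subgroup.one_K[OF fs, of n] by (simp add: res_def)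
    qed
    show "(\<Sum>z\<in>Irr G (H (Suc 0)). of_bool (covers G H 0 z x) * of_bool (covers G H 0 z y)) = (if x = y then r else 0)"
      if xy: "x \<in> Irr G (H 0)" "y \<in> Irr G (H 0)" for x y
    proof -
      have "(\<lambda>g. of_int r * x g) = res (H 0) (ind G (H 0) (H (Suc 0)) x)"
        using rel[OF irr_vchar[OF xy(1)]] by auto
      then have "(if x = y then of_int r else 0)
          = (\<Sum>z\<in>Irr G (H (Suc 0)). of_bool (covers G H 0 z x) * of_bool (covers G H 0 z y) :: complex)"
        using up[OF xy] on[OF xy] by simp
      \<comment> \<open>The identity between complex numbers has integer sides and is pulled back
        along the injective \<open>of_int\<close>.\<close>
      then have "of_int (\<Sum>z\<in>Irr G (H (Suc 0)). of_bool (covers G H 0 z x) * of_bool (covers G H 0 z y))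
          = (of_int (if x = y then r else 0) :: complex)" by (cases "x = y") simp_all
      then show ?thesis unfolding of_int_eq_iff .
    qed
    show "(\<Sum>z\<in>Irr G (H (Suc (Suc n))). of_bool (covers G H (Suc n) z x) * of_bool (covers G H (Suc n) z y))
        = (\<Sum>w\<in>Irr G (H n). of_bool (covers G H n x w) * of_bool (covers G H n y w)) + (if x = y then r else 0)"
      if xy: "x \<in> Irr G (H (Suc n))" "y \<in> Irr G (H (Suc n))" for n x y
    proof -
      have "res (H (Suc n)) (ind G (H (Suc n)) (H (Suc (Suc n))) x)
          = (\<lambda>g. ind G (H n) (H (Suc n)) (res (H n) x) g + of_int r * x g)"
        using rel[OF irr_vchar[OF xy(1)]] by (auto simp: algebra_simps)
      then have "(\<Sum>z\<in>Irr G (H (Suc (Suc n))). of_bool (covers G H (Suc n) z x) * of_bool (covers G H (Suc n) z y))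
          = (\<Sum>w\<in>Irr G (H n). of_bool (covers G H n x w) * of_bool (covers G H n y w)) + (if x = y then of_int r else 0 :: complex)"
        using up[OF xy] down[OF xy] on[OF xy] by (simp add: cinner_add)
      then have "of_int (\<Sum>z\<in>Irr G (H (Suc (Suc n))). of_bool (covers G H (Suc n) z x) * of_bool (covers G H (Suc n) z y))
          = (of_int ((\<Sum>w\<in>Irr G (H n). of_bool (covers G H n x w) * of_bool (covers G H n y w)) + (if x = y then r else 0)) :: complex)"
        by (cases "x = y") simp_all
      then show ?thesis unfolding of_int_eq_iff .
    qed
  qed
qed

section \<open>The last invariant factor for a tower\<close>

theorem theorem6p12:
  fixes G :: "('a, 'b) monoid_scheme" and H :: "nat \<Rightarrow> 'a set"
    and r k :: int and n :: nat
    and e e' :: "nat \<Rightarrow> 'a \<Rightarrow> complex" and S :: "int mat"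
  assumes tower: "differential_tower G H r"
    and e: "bij_betw e {..<card (Irr G (H n))} (Irr G (H n))"
    and e': "bij_betw e' {..<card (Irr G (H (Suc n)))} (Irr G (H (Suc n)))"
    and snf: "is_SNF (DUk_mat G H n e e' k) S"
  shows "(det (DUk_mat G H n e e' k) = 0 \<longrightarrow>
            S $$ (card (Irr G (H n)) - 1, card (Irr G (H n)) - 1) = 0)
       \<and> (det (DUk_mat G H n e e' k) \<noteq> 0 \<longrightarrow>
            (r \<ge> 2 \<longrightarrow> \<bar>S $$ (card (Irr G (H n)) - 1, card (Irr G (H n)) - 1)\<bar>
                          = \<bar>rkfact r k (int n + 1)\<bar>)
          \<and> (r = 1 \<longrightarrow> \<bar>S $$ (card (Irr G (H n)) - 1, card (Irr G (H n)) - 1)\<bar>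
                          = \<bar>rkfact 1 k (int n - 1) * (int n + 1 + k)\<bar>))"
proof -
  interpret D: differential_poset "\<lambda>n. Irr G (H n)" "covers G H" r
    by (rule differential_tower_poset[OF tower])
  let ?p = "card (Irr G (H n))" and ?q = "card (Irr G (H (Suc n)))"
  let ?A = "DUk_mat G H n e e' k"
  let ?U = "up_mat G H n e e'"
  have U: "?U \<in> carrier_mat ?q ?p" by (simp add: up_mat_def)
  have A: "?A \<in> carrier_mat ?p ?p" using U by (simp add: DUk_mat_def)
  have einj: "e i = e j \<longleftrightarrow> i = j" if "i < ?p" "j < ?p" for i j
    using e that by (auto simp: bij_betw_def inj_on_def)
  have eI: "e i \<in> Irr G (H n)" if "i < ?p" for i using e that by (auto simp: bij_betw_def)
  \<comment> \<open>The matrix product sums over indices of rank \<open>n + 1\<close>; reindexing by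
    \<open>e'\<close> gives the sum over the poset.\<close>
  have ent: "?A $$ (i, j) = D.DU n (e i) (e j) + (if e i = e j then k else 0)" if ij: "i < ?p" "j < ?p" for i j
  proof -
    have "(transpose_mat ?U * ?U) $$ (i, j) = (\<Sum>l<?q. ?U $$ (l, i) * ?U $$ (l, j))"
      by (subst index_mult_mat_sum[of _ ?p ?q _ ?p]) (use U ij in auto)
    also have "\<dots> = (\<Sum>l<?q. of_bool (covers G H n (e' l) (e i)) * of_bool (covers G H n (e' l) (e j)))"
      by (rule sum.cong) (use ij in \<open>auto simp: up_mat_def\<close>)
    also have "\<dots> = D.DU n (e i) (e j)" unfolding D.DU_def by (rule sum.reindex_bij_betw[OF e'])
    finally show ?thesis using ij U by (simp add: DUk_mat_def einj)
  qed
  have last: "\<bar>S $$ (?p - 1, ?p - 1)\<bar> = \<bar>c\<bar>"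
    if d: "det ?A \<noteq> 0" and c: "r \<ge> 2 \<and> c = rkfact r k (int n + 1)
      \<or> r = 1 \<and> c = rkfact 1 k (int n - 1) * (int n + 1 + k)" for c
  proof -
    from D.scaled_inverse_exists[OF c[unfolded rkfact_def]] obtain N y z
      where N: "D.scaled_inverse n k N c" and yz: "y \<in> Irr G (H n)" "z \<in> Irr G (H n)" "\<bar>N y z\<bar> = 1"
      by blast
    \<comment> \<open>The poset-indexed \<open>N\<close> is transported along \<open>e\<close> to an
      integer matrix, so that its entry of absolute value 1 certifies primitivity.\<close>
    define M where "M = mat ?p ?p (\<lambda>(i, j). N (e i) (e j))"
    have M: "M \<in> carrier_mat ?p ?p" by (simp add: M_def)
    have "?A * M = c \<cdot>\<^sub>m 1\<^sub>m ?p"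
    proof (rule eq_matI)
      fix i j assume "i < dim_row (c \<cdot>\<^sub>m 1\<^sub>m ?p)" "j < dim_col (c \<cdot>\<^sub>m 1\<^sub>m ?p)"
      then have ij: "i < ?p" "j < ?p" by auto
      have "(?A * M) $$ (i, j) = (\<Sum>l<?p. (D.DU n (e i) (e l) + (if e i = e l then k else 0)) * N (e l) (e j))"
        unfolding index_mult_mat_sum[OF A M ij] by (rule sum.cong) (use ij ent in \<open>auto simp: M_def\<close>)
      also have "\<dots> = (\<Sum>v\<in>Irr G (H n). (D.DU n (e i) v + (if e i = v then k else 0)) * N v (e j))"
        by (rule sum.reindex_bij_betw[OF e])
      also have "\<dots> = (if e i = e j then c else 0)" using N eI ij by (simp add: D.scaled_inverse_def)
      finally show "(?A * M) $$ (i, j) = (c \<cdot>\<^sub>m 1\<^sub>m ?p) $$ (i, j)" using ij by (simp add: einj)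
    qed (use A M in auto)
    then have eq: "i < ?p \<Longrightarrow> j < ?p \<Longrightarrow> \<bar>M $$ (i, j)\<bar> = 1 \<Longrightarrow> \<bar>S $$ (?p - 1, ?p - 1)\<bar> = \<bar>c\<bar>" for i j
      by (rule is_SNF_last_eq[OF snf A d M])
    have "y \<in> e ` {..<?p}" "z \<in> e ` {..<?p}" using yz e by (simp_all add: bij_betw_def)
    then obtain i j where ij: "i < ?p" "j < ?p" "y = e i" "z = e j" by auto
    with yz(3) have "\<bar>M $$ (i, j)\<bar> = 1" by (simp add: M_def)
    from eq[OF ij(1,2) this] show ?thesis .
  qed
  show ?thesis using is_SNF_last_eq_0[OF snf A] last by blast
qed

end
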